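(* Let $\alpha:G\to\mathrm{Aut}(\mathcal C)$ be a strongly continuous, ergodic action of a compact group $G$ on a unital $C^*$-algebra $\mathcal C$. Then the following conditions are equivalent: (a) $\mathcal C$ has a character; (b) $\mathcal C$ is commutative. If one of these conditions is satisfied, the dynamical system $(\mathcal C,\alpha)$ is isomorphic to the system arising from a quotient right $G$-space, i.e. there are a closed subgroup $K$ of $G$ and a $*$-isomorphism $\mathcal C\to\mathcal C(K\backslash G)$ intertwining $\alpha$ with the action $(g\cdot f)(x)=f(xg)$, $x\in K\backslash G$.
   Context: A character of $\mathcal C$ is a nonzero (hence unital) $*$-homomorphism $\mathcal C\to\mathbb C$. The action is strongly continuous if $g\mapsto\alpha_g(c)$ is norm continuous for each $c\in\mathcal C$, and ergodic if $\{c:\alpha_g(c)=c\ \forall g\in G\}=\mathbb CI$. $K\backslash G$ is the compact space of right cosets $Kg_1$, with right $G$-action $Kg_1\mapsto Kg_1g$; $\mathcal C(K\backslash G)$ is the $C^*$-algebra of continuous functions on it. *)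

theory Defs
  imports "HOL-Analysis.Analysis" "HOL-Algebra.Coset"
begin

section \<open>Unital C*-algebras\<close>

text \<open>
  The classes \<^class>\<open>real_normed_algebra_1\<close> and \<^class>\<open>banach\<close> provide a complete submultiplicative
  norm with \<open>norm 1 = 1\<close>, so a unital C*-algebra is nonzero here. The complex scalar
  multiplication extends the real one.
\<close>

class unital_cstar_algebra = real_normed_algebra_1 + banach +
  fixes scaleC :: "complex \<Rightarrow> 'a \<Rightarrow> 'a" (infixr \<open>*\<^sub>C\<close> 75)
    and star :: "'a \<Rightarrow> 'a"
  assumes scaleC_add_right: "z *\<^sub>C (a + b) = z *\<^sub>C a + z *\<^sub>C b"
    and scaleC_add_left: "(z + w) *\<^sub>C a = z *\<^sub>C a + w *\<^sub>C a"
    and scaleC_scaleC: "z *\<^sub>C (w *\<^sub>C a) = (z * w) *\<^sub>C a"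
    and scaleC_of_real: "complex_of_real r *\<^sub>C a = r *\<^sub>R a"
    and mult_scaleC_left: "(z *\<^sub>C a) * b = z *\<^sub>C (a * b)"
    and mult_scaleC_right: "a * (z *\<^sub>C b) = z *\<^sub>C (a * b)"
    and norm_scaleC: "norm (z *\<^sub>C a) = cmod z * norm a"
    and star_add: "star (a + b) = star a + star b"
    and star_scaleC: "star (z *\<^sub>C a) = cnj z *\<^sub>C star a"
    and star_mult: "star (a * b) = star b * star a"
    and star_star: "star (star a) = a"
    and cstar_identity: "norm (star a * a) = (norm a)\<^sup>2"

instantiation complex :: unital_cstar_algebra
begin

definition scaleC_complex :: "complex \<Rightarrow> complex \<Rightarrow> complex"
  where "scaleC_complex z w = z * w"

definition star_complex :: "complex \<Rightarrow> complex"
  where "star_complex z = cnj z"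

instance
  by standard
    (auto simp: scaleC_complex_def star_complex_def algebra_simps norm_mult scaleR_conv_of_real
      power2_eq_square)

end

definition star_hom :: "('a::unital_cstar_algebra \<Rightarrow> 'b::unital_cstar_algebra) \<Rightarrow> bool"
  where "star_hom f \<longleftrightarrow>
    (\<forall>a b. f (a + b) = f a + f b) \<and>
    (\<forall>z a. f (z *\<^sub>C a) = z *\<^sub>C f a) \<and>
    (\<forall>a b. f (a * b) = f a * f b) \<and>
    (\<forall>a. f (star a) = star (f a))"

definition character :: "('a::unital_cstar_algebra \<Rightarrow> complex) \<Rightarrow> bool"
  where "character \<phi> \<longleftrightarrow> star_hom \<phi> \<and> (\<exists>a. \<phi> a \<noteq> 0)"

definition star_Aut :: "('a::unital_cstar_algebra \<Rightarrow> 'a) monoid"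
  where "star_Aut = \<lparr>carrier = {f. star_hom f \<and> bij f}, monoid.mult = (\<circ>), one = id\<rparr>"


section \<open>Compact groups and their spaces of right cosets\<close>

locale compact_group = group G for G :: "('g, 'm) monoid_scheme" +
  fixes T :: "'g topology"
  assumes topspace_eq: "topspace T = carrier G"
    and continuous_mult: "continuous_map (prod_topology T T) T (\<lambda>(x, y). x \<otimes>\<^bsub>G\<^esub> y)"
    and continuous_inv: "continuous_map T T (\<lambda>x. inv\<^bsub>G\<^esub> x)"
    and compact: "compact_space T"
    and Hausdorff: "Hausdorff_space T"

text \<open>
  The quotient topology on the set of right cosets: since a family \<open>U\<close> of cosets has preimage
  \<open>\<Union>U\<close> under \<open>g \<mapsto> K g\<close>, it is open iff \<open>\<Union>U\<close> is open in the group. The lemmas below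
  confirm that this family of sets is a topology and that the projection is a quotient map.
\<close>

definition right_coset_space ::
    "('g, 'm) monoid_scheme \<Rightarrow> 'g topology \<Rightarrow> 'g set \<Rightarrow> 'g set topology"
  where "right_coset_space G T K =
    topology (\<lambda>U. U \<subseteq> rcosets\<^bsub>G\<^esub> K \<and> openin T (\<Union>U))"

context compact_group
begin

lemma openin_right_coset_space:
  assumes "subgroup K G"
  shows "openin (right_coset_space G T K) U \<longleftrightarrow> U \<subseteq> rcosets\<^bsub>G\<^esub> K \<and> openin T (\<Union>U)"
proof -
  have disj: "A \<inter> B = {}" if "A \<in> rcosets\<^bsub>G\<^esub> K" "B \<in> rcosets\<^bsub>G\<^esub> K" "A \<noteq> B" for A B
    using rcos_disjoint[OF assms] that by (simp add: pairwise_def disjnt_def)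
  have "istopology (\<lambda>U. U \<subseteq> rcosets\<^bsub>G\<^esub> K \<and> openin T (\<Union>U))"
    unfolding istopology_def
  proof (intro conjI allI impI)
    fix S U
    assume S: "S \<subseteq> rcosets\<^bsub>G\<^esub> K \<and> openin T (\<Union>S)" and U: "U \<subseteq> rcosets\<^bsub>G\<^esub> K \<and> openin T (\<Union>U)"
    have "\<Union>S \<inter> \<Union>U \<subseteq> \<Union>(S \<inter> U)"
    proof
      fix g assume "g \<in> \<Union>S \<inter> \<Union>U"
      then obtain A B where AB: "A \<in> S" "g \<in> A" "B \<in> U" "g \<in> B"
        by blast
      then have "A = B"
        using disj[of A B] S U by blast
      then show "g \<in> \<Union>(S \<inter> U)"
        using AB by blast
    qed
    then have "\<Union>(S \<inter> U) = \<Union>S \<inter> \<Union>U"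
      by blast
    then show "openin T (\<Union>(S \<inter> U))"
      using S U by (simp add: openin_Int)
    show "S \<inter> U \<subseteq> rcosets\<^bsub>G\<^esub> K"
      using S by auto
  next
    fix \<K>
    assume *: "\<forall>U\<in>\<K>. U \<subseteq> rcosets\<^bsub>G\<^esub> K \<and> openin T (\<Union>U)"
    then show "\<Union>\<K> \<subseteq> rcosets\<^bsub>G\<^esub> K"
      by blast
    have "\<Union>(\<Union>\<K>) = \<Union>(Union ` \<K>)"
      by blast
    moreover have "openin T (\<Union>(Union ` \<K>))"
      using * by (intro openin_Union) blast
    ultimately show "openin T (\<Union>(\<Union>\<K>))" by simp
  qed
  then show ?thesis
    by (simp add: right_coset_space_def topology_inverse')
qed

lemma topspace_right_coset_space:
  assumes "subgroup K G"
  shows "topspace (right_coset_space G T K) = rcosets\<^bsub>G\<^esub> K"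
proof -
  have "openin T (\<Union>(rcosets\<^bsub>G\<^esub> K))"
    using openin_topspace[of T] by (simp only: rcosets_part_G[OF assms] topspace_eq)
  then have "openin (right_coset_space G T K) (rcosets\<^bsub>G\<^esub> K)"
    by (simp only: openin_right_coset_space[OF assms]) simp
  moreover have "topspace (right_coset_space G T K) \<subseteq> rcosets\<^bsub>G\<^esub> K"
    using openin_topspace[of "right_coset_space G T K"]
    by (simp only: openin_right_coset_space[OF assms])
  ultimately show ?thesis
    by (meson openin_subset subset_antisym)
qed

lemma quotient_map_right_coset_space:
  assumes "subgroup K G"
  shows "quotient_map T (right_coset_space G T K) (\<lambda>g. K #>\<^bsub>G\<^esub> g)"
proof -
  have preimage: "{g \<in> carrier G. K #>\<^bsub>G\<^esub> g \<in> U} = \<Union>U" if U: "U \<subseteq> rcosets\<^bsub>G\<^esub> K" for U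
  proof (intro equalityI subsetI)
    fix g assume "g \<in> {g \<in> carrier G. K #>\<^bsub>G\<^esub> g \<in> U}"
    then show "g \<in> \<Union>U"
      using rcos_self[OF _ assms] by blast
  next
    fix g assume "g \<in> \<Union>U"
    then obtain A where A: "A \<in> U" "g \<in> A" by blast
    then obtain h where h: "h \<in> carrier G" "A = K #>\<^bsub>G\<^esub> h"
      using U by (auto simp: RCOSETS_def)
    then have "K #>\<^bsub>G\<^esub> g = A"
      using repr_independence[OF _ _ assms] A by blast
    moreover have "g \<in> carrier G"
      using A h(2) r_coset_subset_G[OF subgroup.subset[OF assms] h(1)] by blast
    ultimately show "g \<in> {g \<in> carrier G. K #>\<^bsub>G\<^esub> g \<in> U}"
      using A by blast
  qed
  have "(\<lambda>g. K #>\<^bsub>G\<^esub> g) ` carrier G = rcosets\<^bsub>G\<^esub> K"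
    by (auto simp: RCOSETS_def)
  then show ?thesis
    unfolding quotient_map_def topspace_right_coset_space[OF assms]
      openin_right_coset_space[OF assms] topspace_eq
    using preimage by simp
qed

end


section \<open>Actions\<close>

locale ergodic_action = compact_group G T
  for G :: "('g, 'm) monoid_scheme" and T :: "'g topology" +
  fixes \<alpha> :: "'g \<Rightarrow> 'c::unital_cstar_algebra \<Rightarrow> 'c"
  assumes action: "\<alpha> \<in> hom G star_Aut"
    and strongly_continuous: "continuous_map T euclidean (\<lambda>g. \<alpha> g c)"
    and ergodic: "{c. \<forall>g\<in>carrier G. \<alpha> g c = c} = range (\<lambda>z. z *\<^sub>C 1)"

text \<open>
  The underlying set of \<open>C(X)\<close>; functions are normalised to be \<^const>\<open>undefined\<close> off \<open>X\<close>, so that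
  distinct elements differ at some point of \<open>X\<close>.
\<close>

definition continuous_functions :: "'x topology \<Rightarrow> ('x \<Rightarrow> complex) set"
  where "continuous_functions X = {f \<in> extensional (topspace X). continuous_map X euclidean f}"

definition star_iso_onto_continuous_functions ::
    "'x topology \<Rightarrow> ('c::unital_cstar_algebra \<Rightarrow> 'x \<Rightarrow> complex) \<Rightarrow> bool"
  where "star_iso_onto_continuous_functions X \<Phi> \<longleftrightarrow>
    bij_betw \<Phi> UNIV (continuous_functions X) \<and>
    (\<forall>a b. \<forall>x\<in>topspace X. \<Phi> (a + b) x = \<Phi> a x + \<Phi> b x) \<and>
    (\<forall>z a. \<forall>x\<in>topspace X. \<Phi> (z *\<^sub>C a) x = z * \<Phi> a x) \<and>
    (\<forall>a b. \<forall>x\<in>topspace X. \<Phi> (a * b) x = \<Phi> a x * \<Phi> b x) \<and>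
    (\<forall>a. \<forall>x\<in>topspace X. \<Phi> (star a) x = cnj (\<Phi> a x))"

end

theory Submission
  imports Defs
begin

text \<open>
  Let \<open>\<phi>\<close> be a character and consider the homomorphism that sends \<open>c\<close> to the continuous function
  \<open>g \<mapsto> \<phi> (\<alpha> g c)\<close> on the group. It is equivariant for right translation. The heart of the matter is that
  it is injective. The closed convex hull of the orbit of \<open>c\<^sup>2\<close>, for self-adjoint \<open>c\<close>, is compact and so contains
  a point fixed by the isometric action, which is a scalar by ergodicity
  (\<open>exists_scalar_in_closed_hull\<close>). If the function of \<open>c\<close> is zero, then \<open>\<phi>\<close> vanishes on the
  hull and the scalar is zero. But a nonzero square cannot have mean zero, because by
  compactness finitely many translates of anything in its hull add up to an element that dominates the
  square approximately (\<open>zero_if_zero_in_closed_hull\<close>). Hence \<open>c = 0\<close>.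

  Applied to the positive part of \<open>c - N\<close>, injectivity implies that the homomorphism is isometric
  (\<open>norm_le_of_character_bound\<close>). Consequently the algebra is commutative, and by the
  Stone--Weierstrass theorem and completeness its image consists of all continuous functions that
  are constant on the fibres of \<open>g \<mapsto> \<phi> \<circ> \<alpha> g\<close>. These fibres are the right cosets \<open>K g\<close> of the stabilizer
  \<open>K\<close> of \<open>\<phi>\<close>, so the image is the algebra of continuous functions on the coset space
  (\<open>gelfand_transform_star_iso\<close>).

  Conversely, every commutative unital C*-algebra has a character
  (\<open>exists_character_if_commutative\<close>): a maximal preordering on the self-adjoint part is total, and
  each element is infinitesimally close to exactly one real number.

  All facts about positivity come from two elementary sources. One is the inequality
  \<open>\<parallel>a\<^sup>2\<parallel> \<le> \<parallel>a\<^sup>2 + c\<^sup>2\<parallel>\<close> for commuting self-adjoint elements. The other is the existence of square roots of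
  \<open>1 - h\<close> for self-adjoint \<open>h\<close> of norm at most one, found by iteration. The positive cone is described by
  the norm condition \<open>\<parallel>t - b\<parallel> \<le> t\<close>, which makes its convexity evident.
\<close>

section \<open>Separation in function spaces\<close>

text \<open>
  The orbit of a character will be a compact set of functions on the algebra with the topology of
  pointwise convergence. The Stone--Weierstrass theorem is stated for Hausdorff type classes, so
  the separation axioms have to be lifted to function types. The weaker classes come first because
  arities of a class must be at least as general as those of its subclasses.
\<close>

lemma open_coordinate_preimage:
  assumes "open W"
  shows "open {z :: 'a \<Rightarrow> 'b::topological_space. z i \<in> W}"
  using open_vimage[OF assms, of "\<lambda>z. z i"] by (simp add: vimage_def)

instance "fun" :: (type, t0_space) t0_space
proof
  fix x y :: "'a \<Rightarrow> 'b"
  assume "x \<noteq> y"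
  then obtain i where i: "x i \<noteq> y i" by blast
  obtain U where "open U" "\<not> (x i \<in> U \<longleftrightarrow> y i \<in> U)"
    using i by (auto simp: separation_t0)
  then show "\<exists>U. open U \<and> \<not> (x \<in> U \<longleftrightarrow> y \<in> U)"
    by (intro exI[of _ "{z. z i \<in> U}"]) (simp add: open_coordinate_preimage)
qed

instance "fun" :: (type, t1_space) t1_space
proof
  fix x y :: "'a \<Rightarrow> 'b"
  assume "x \<noteq> y"
  then obtain i where i: "x i \<noteq> y i" by blast
  obtain U where "open U" "x i \<in> U" "y i \<notin> U"
    using i by (auto simp: separation_t1)
  then show "\<exists>U. open U \<and> x \<in> U \<and> y \<notin> U"
    by (intro exI[of _ "{z. z i \<in> U}"]) (simp add: open_coordinate_preimage)
qed

instance "fun" :: (type, t2_space) t2_space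
proof
  fix x y :: "'a \<Rightarrow> 'b"
  assume "x \<noteq> y"
  then obtain i where i: "x i \<noteq> y i" by blast
  obtain U V where "open U" "open V" "x i \<in> U" "y i \<in> V" "U \<inter> V = {}"
    using hausdorff[OF i] by blast
  then show "\<exists>U V. open U \<and> open V \<and> x \<in> U \<and> y \<in> V \<and> U \<inter> V = {}"
    by (intro exI[of _ "{z. z i \<in> U}"] exI[of _ "{z. z i \<in> V}"])
      (auto simp: open_coordinate_preimage)
qed

section \<open>The involution\<close>

lemma star_one [simp]: "star (1::'a::unital_cstar_algebra) = 1"
  by (metis mult.left_neutral mult.right_neutral star_mult star_star)

lemma star_scaleR [simp]: "star (r *\<^sub>R a) = r *\<^sub>R star (a::'a::unital_cstar_algebra)"
  by (metis complex_cnj_complex_of_real scaleC_of_real star_scaleC)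

lemma star_minus [simp]: "star (- a) = - star (a::'a::unital_cstar_algebra)"
  using star_scaleR[of "-1" a] by simp

lemma star_diff [simp]: "star (a - b) = star a - star (b::'a::unital_cstar_algebra)"
  using star_add[of a "-b"] by simp

lemma star_zero [simp]: "star (0::'a::unital_cstar_algebra) = 0"
  using star_scaleR[of 0 0] by simp

lemma star_of_real [simp]: "star (of_real r) = (of_real r :: 'a::unital_cstar_algebra)"
  by (simp add: of_real_def)

lemma norm_star [simp]: "norm (star a) = norm (a::'a::unital_cstar_algebra)"
proof -
  have le: "norm b \<le> norm (star b)" for b :: 'a
  proof (cases "b = 0")
    case False
    have "norm b * norm b \<le> norm (star b) * norm b"
      using norm_mult_ineq[of "star b" b] by (simp add: cstar_identity power2_eq_square)
    then show ?thesis using False by simp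
  qed simp
  show ?thesis using le[of a] le[of "star a"] by (simp add: star_star)
qed

lemma bounded_linear_star: "bounded_linear (star :: 'a::unital_cstar_algebra \<Rightarrow> 'a)"
  by (rule bounded_linear_intro[of _ 1]) (simp_all add: star_add)

lemmas tendsto_star = bounded_linear.tendsto[OF bounded_linear_star]

lemma scaleC_minus_left: "(- z) *\<^sub>C a = - (z *\<^sub>C (a::'a::unital_cstar_algebra))"
proof -
  have "(- z) *\<^sub>C a = ((-1) * z) *\<^sub>C a" by simp
  also have "\<dots> = complex_of_real (-1) *\<^sub>C z *\<^sub>C a" by (simp add: scaleC_scaleC)
  finally show ?thesis by (simp only: scaleC_of_real) simp
qed

lemma scaleC_minus_right: "z *\<^sub>C (- a) = - (z *\<^sub>C (a::'a::unital_cstar_algebra))"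
  using mult_scaleC_right[of "-1" z a] by simp

lemma scaleC_diff_right: "z *\<^sub>C (a - b) = z *\<^sub>C a - z *\<^sub>C (b::'a::unital_cstar_algebra)"
  using scaleC_add_right[of z a "- b"] by (simp add: scaleC_minus_right)

section \<open>Square roots\<close>

text \<open>
  For commuting self-adjoint elements, \<open>z = a + \<i> c\<close> has \<open>z\<^sup>* z = a\<^sup>2 + c\<^sup>2\<close>, and \<open>a\<close> is the real part of
  \<open>z\<close>, hence no longer than \<open>z\<close>. All the order theory below rests on this inequality.
\<close>

lemma norm_square_le_norm_sum_squares:
  fixes a c :: "'a::unital_cstar_algebra"
  assumes "star a = a" "star c = c" "a * c = c * a"
  shows "norm (a * a) \<le> norm (a * a + c * c)"
proof -
  define z where "z = a + \<i> *\<^sub>C c"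
  have sz: "star z = a - \<i> *\<^sub>C c"
    using assms by (simp add: z_def star_add star_scaleC scaleC_minus_left)
  have "star z * z = a * a + c * c"
    unfolding sz unfolding z_def
    using assms(3) scaleC_of_real[of "-1" "c * c"]
    by (simp add: algebra_simps mult_scaleC_left mult_scaleC_right scaleC_scaleC
        scaleC_add_right scaleC_diff_right)
  then have z: "norm (a * a + c * c) = (norm z)\<^sup>2"
    by (metis cstar_identity)
  have "2 *\<^sub>R a = z + star z"
    unfolding sz by (simp add: z_def scaleR_2)
  then have "2 * norm a \<le> norm z + norm (star z)"
    by (metis norm_scaleR norm_triangle_ineq abs_numeral)
  then have "norm a \<le> norm z" by simp
  then have "(norm a)\<^sup>2 \<le> (norm z)\<^sup>2" by (simp add: power_mono)
  moreover have "norm (a * a) = (norm a)\<^sup>2" using cstar_identity[of a] assms by simp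
  ultimately show ?thesis using z by simp
qed

text \<open>
  A square root \<open>1 - r\<close> of \<open>1 - h\<close> is a solution of the fixed point equation \<open>r = (h + r\<^sup>2) / 2\<close>. For
  \<open>h = 1\<close> in the real numbers the iteration increases to \<open>1\<close>, and it dominates the iteration for every
  \<open>h\<close> in the unit ball, including its boundary, where the iteration is no longer a contraction.
\<close>

primrec sqrt_iterate :: "'a \<Rightarrow> nat \<Rightarrow> 'a::real_normed_algebra_1" where
  "sqrt_iterate h 0 = 0"
| "sqrt_iterate h (Suc n) = (1/2) *\<^sub>R (h + sqrt_iterate h n * sqrt_iterate h n)"

lemma sqrt_iterate_real:
  "0 \<le> sqrt_iterate (1::real) n \<and> sqrt_iterate (1::real) n \<le> 1
    \<and> sqrt_iterate (1::real) n \<le> sqrt_iterate 1 (Suc n)"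
proof (induction n)
  case (Suc n)
  have "(sqrt_iterate (1::real) n)\<^sup>2 \<le> (sqrt_iterate (1::real) (Suc n))\<^sup>2"
    using Suc by (intro power_mono) auto
  moreover have "(sqrt_iterate (1::real) n)\<^sup>2 \<le> 1" using Suc by (simp add: power_le_one)
  ultimately show ?case by (simp add: power2_eq_square)
qed simp

lemma sqrt_iterate_dominated:
  fixes h :: "'a::real_normed_algebra_1"
  assumes "norm h \<le> 1"
  shows "norm (sqrt_iterate h n) \<le> sqrt_iterate 1 n \<and>
    norm (sqrt_iterate h (Suc n) - sqrt_iterate h n) \<le> sqrt_iterate 1 (Suc n) - sqrt_iterate 1 n"
proof (induction n)
  case 0 then show ?case using assms by simp
next
  case (Suc n)
  let ?r = "sqrt_iterate h" and ?q = "sqrt_iterate (1::real)"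
  have mult: "norm (x * y) \<le> p * q" if "norm x \<le> p" "norm y \<le> q" for x y :: 'a and p q
    using that by (intro order_trans[OF norm_mult_ineq] mult_mono) (auto intro: order_trans[OF norm_ge_zero])
  have 1: "norm (?r (Suc n)) \<le> ?q (Suc n)"
  proof -
    have "norm (h + ?r n * ?r n) \<le> 1 + ?q n * ?q n"
      using assms mult[of "?r n" "?q n" "?r n" "?q n"] Suc norm_triangle_ineq[of h "?r n * ?r n"]
      by linarith
    then show ?thesis by simp
  qed
  have "?r (Suc (Suc n)) - ?r (Suc n) =
      (1/2) *\<^sub>R (?r (Suc n) * (?r (Suc n) - ?r n) + (?r (Suc n) - ?r n) * ?r n)" 
    by (simp only: sqrt_iterate.simps(2)[of h "Suc n"] sqrt_iterate.simps(2)[of h "n"]) (simp add: algebra_simps)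
  also have "norm \<dots> \<le> (1/2) * (?q (Suc n) * (?q (Suc n) - ?q n) + (?q (Suc n) - ?q n) * ?q n)"
  proof -
    have "norm (?r (Suc n) * (?r (Suc n) - ?r n)) \<le> ?q (Suc n) * (?q (Suc n) - ?q n)"
      by (intro mult) (use 1 Suc in blast)+
    moreover have "norm ((?r (Suc n) - ?r n) * ?r n) \<le> (?q (Suc n) - ?q n) * ?q n"
      by (intro mult) (use 1 Suc in blast)+
    ultimately show ?thesis
      using norm_triangle_ineq[of "?r (Suc n) * (?r (Suc n) - ?r n)" "(?r (Suc n) - ?r n) * ?r n"] by simp
  qed
  also have "\<dots> = ?q (Suc (Suc n)) - ?q (Suc n)"
    by (simp only: sqrt_iterate.simps(2)[of _ "Suc n"] sqrt_iterate.simps(2)[of _ "n"]) (simp add: algebra_simps)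
  finally show ?case using 1 by blast
qed

text \<open>
  The increments of the iteration are bounded by those of a convergent increasing real sequence, so it
  converges. Each iterate is a polynomial in \<open>h\<close>, which explains why the root is self-adjoint and commutes
  with everything that commutes with \<open>h\<close>.
\<close>

lemma exists_sqrt_of_one_minus:
  fixes h :: "'a::unital_cstar_algebra"
  assumes sa: "star h = h" and h: "norm h \<le> 1"
  obtains s where "star s = s" "s * s = 1 - h" "norm (1 - s) \<le> 1"
    "\<And>x. x * h = h * x \<Longrightarrow> x * s = s * x"
proof -
  let ?r = "sqrt_iterate h" and ?q = "sqrt_iterate (1::real)"
  have mono: "incseq ?q" using sqrt_iterate_real by (intro incseq_SucI) blast
  have tele: "norm (?r (n + k) - ?r n) \<le> ?q (n + k) - ?q n" for n k
  proof (induction k)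
    case (Suc k)
    have "norm (?r (n + Suc k) - ?r n) \<le> norm (?r (Suc (n + k)) - ?r (n + k)) + norm (?r (n + k) - ?r n)"
      using norm_triangle_ineq[of "?r (Suc (n + k)) - ?r (n + k)" "?r (n + k) - ?r n"] by simp
    then show ?case using Suc sqrt_iterate_dominated[OF h, of "n + k"] by simp
  qed simp
  have "Cauchy ?q"
  proof -
    obtain L where "?q \<longlonglongrightarrow> L"
      using incseq_convergent[OF mono, of 1] sqrt_iterate_real by blast
    then show ?thesis by (rule LIMSEQ_imp_Cauchy)
  qed
  have "Cauchy ?r"
  proof (rule CauchyI)
    fix e :: real assume "e > 0"
    then obtain M where M: "\<And>m n. m \<ge> M \<Longrightarrow> n \<ge> M \<Longrightarrow> norm (?q m - ?q n) < e"
      using CauchyD[OF \<open>Cauchy ?q\<close>] by metis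
    have le: "norm (?r m - ?r n) < e" if "n \<ge> M" "n \<le> m" for m n
      using tele[of n "m - n"] M[of m n] that by simp
    have "norm (?r m - ?r n) < e" if "m \<ge> M" "n \<ge> M" for m n
      using le[of n m] le[of m n] that by (cases "n \<le> m") (auto simp: norm_minus_commute)
    then show "\<exists>M. \<forall>m\<ge>M. \<forall>n\<ge>M. norm (?r m - ?r n) < e" by blast
  qed
  then obtain r where r: "?r \<longlonglongrightarrow> r" using Cauchy_convergent convergent_def by blast
  have "(\<lambda>n. ?r (Suc n)) \<longlonglongrightarrow> (1/2) *\<^sub>R (h + r * r)"
    by (simp only: sqrt_iterate.simps) (intro tendsto_intros r)
  then have fixp: "r = (1/2) *\<^sub>R (h + r * r)"
    using LIMSEQ_unique LIMSEQ_Suc[OF r] by blast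
  have "star (?r n) = ?r n" for n by (induction n) (auto simp: star_add star_mult sa)
  then have "?r \<longlonglongrightarrow> star r" using tendsto_star[OF r] by simp
  then have rsa: "star r = r" using r by (rule LIMSEQ_unique)
  have "norm (?r n) \<le> 1" for n
    using sqrt_iterate_dominated[OF h, of n] sqrt_iterate_real[of n] by linarith
  then have rn: "norm r \<le> 1" using LIMSEQ_le_const2[OF tendsto_norm[OF r]] by blast
  have comm: "x * r = r * x" if x: "x * h = h * x" for x
  proof -
    have "x * ?r n = ?r n * x" for n
      by (induction n) (simp_all add: algebra_simps x, metis mult.assoc)
    then have "(\<lambda>n. x * ?r n) \<longlonglongrightarrow> r * x" using tendsto_mult_right[OF r, of x] by simp
    with tendsto_mult_left[OF r, of x] show ?thesis by (rule LIMSEQ_unique)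
  qed
  have "2 *\<^sub>R r = h + r * r" using arg_cong[OF fixp, of "\<lambda>y. 2 *\<^sub>R y"] by simp
  then have "(1 - r) * (1 - r) = 1 - h" by (simp add: algebra_simps scaleR_2)
  then show thesis
  proof (rule that[rotated])
    show "star (1 - r) = 1 - r" using rsa by simp
    show "norm (1 - (1 - r)) \<le> 1" using rn by simp
    show "x * (1 - r) = (1 - r) * x" if "x * h = h * x" for x
      using comm[OF that] by (simp only: right_diff_distrib left_diff_distrib) simp
  qed
qed

section \<open>The positive cone\<close>

text \<open>
  For self-adjoint \<open>b\<close> this says that the spectrum is nonnegative. In this form the cone is obviously
  closed under sums, which would be the hard part with a definition by squares.
\<close>

definition positive_cone :: "'a::unital_cstar_algebra set"
  where "positive_cone = {b. \<exists>t. norm (of_real t - b) \<le> t}"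

lemma positive_coneI: "norm (of_real t - b) \<le> t \<Longrightarrow> b \<in> positive_cone"
  by (auto simp: positive_cone_def)

lemma positive_coneE:
  assumes "b \<in> positive_cone"
  obtains t where "t \<ge> 0" "norm (of_real t - b) \<le> t"
  using assms order_trans[OF norm_ge_zero] unfolding positive_cone_def by blast

lemma positive_cone_add:
  assumes "a \<in> positive_cone" "b \<in> positive_cone"
  shows "a + b \<in> positive_cone"
proof -
  obtain s t where "norm (of_real s - a) \<le> s" "norm (of_real t - b) \<le> t"
    using assms by (auto simp: positive_cone_def)
  moreover have "of_real (s + t) - (a + b) = (of_real s - a) + (of_real t - b)" by simp
  ultimately have "norm (of_real (s + t) - (a + b)) \<le> s + t"
    using norm_triangle_ineq[of "of_real s - a" "of_real t - b"] by (metis add_mono order_trans)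
  then show ?thesis by (rule positive_coneI)
qed

lemma positive_cone_scaleR:
  assumes "b \<in> positive_cone" "r \<ge> 0"
  shows "r *\<^sub>R b \<in> positive_cone"
proof -
  obtain t where t: "norm (of_real t - b) \<le> t" using assms by (auto simp: positive_cone_def)
  have "of_real (r * t) - r *\<^sub>R b = r *\<^sub>R (of_real t - b)"
    by (simp add: of_real_def scaleR_diff_right)
  then have "norm (of_real (r * t) - r *\<^sub>R b) = r * norm (of_real t - b)" using assms by simp
  also have "\<dots> \<le> r * t" using t assms by (simp add: mult_left_mono)
  finally show ?thesis by (rule positive_coneI)
qed

lemma of_real_mem_positive_cone: "r \<ge> 0 \<Longrightarrow> of_real r \<in> positive_cone"
  by (rule positive_coneI[of r]) simp

lemma of_real_add_mem_positive_cone: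
  fixes a :: "'a::unital_cstar_algebra"
  assumes "norm a \<le> r"
  shows "of_real r + a \<in> positive_cone"
  using assms by (intro positive_coneI[of r]) simp

lemma positive_square_root:
  fixes b :: "'a::unital_cstar_algebra"
  assumes sa: "star b = b" and pos: "b \<in> positive_cone"
  obtains u where "star u = u" "u * u = b" "u \<in> positive_cone" "\<And>x. x * b = b * x \<Longrightarrow> x * u = u * x"
proof -
  obtain t where t: "t \<ge> 0" "norm (of_real t - b) \<le> t" using pos by (rule positive_coneE)
  show thesis
  proof (cases "t = 0")
    case True
    then have "b = 0" using t by simp
    then show thesis using that[of 0] of_real_mem_positive_cone[of 0] by simp
  next
    case False
    define h where "h = (1/t) *\<^sub>R (of_real t - b)"
    have "norm h \<le> 1" "star h = h" using t False sa by (auto simp: h_def)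
    then obtain s where s: "star s = s" "s * s = 1 - h" "norm (1 - s) \<le> 1"
      "\<And>x. x * h = h * x \<Longrightarrow> x * s = s * x"
      using exists_sqrt_of_one_minus by blast
    have b: "b = t *\<^sub>R (1 - h)" using False
      by (simp add: h_def scaleR_diff_right of_real_def)
    have "s \<in> positive_cone" using s(3) by (intro positive_coneI[of 1]) simp
    then have "sqrt t *\<^sub>R s \<in> positive_cone" using t by (simp add: positive_cone_scaleR)
    moreover have "x * (sqrt t *\<^sub>R s) = (sqrt t *\<^sub>R s) * x" if "x * b = b * x" for x
    proof -
      have "x * h = h * x" using that by (simp add: h_def algebra_simps of_real_def)
      then show ?thesis using s(4) by simp
    qed
    moreover have "star (sqrt t *\<^sub>R s) = sqrt t *\<^sub>R s" using s(1) by simp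
    moreover have "(sqrt t *\<^sub>R s) * (sqrt t *\<^sub>R s) = b" using s(2) t(1) b by simp
    ultimately show thesis using that by blast
  qed
qed

text \<open>
  After scaling \<open>a\<close> to norm one, \<open>1 - a\<^sup>2 = s\<^sup>2\<close> with \<open>s\<close> commuting with \<open>a\<close>, and then
  \<open>\<parallel>1 - a\<^sup>2\<parallel> = \<parallel>s\<^sup>2\<parallel> \<le> \<parallel>s\<^sup>2 + a\<^sup>2\<parallel> = 1\<close>.
\<close>

lemma square_mem_positive_cone:
  fixes a :: "'a::unital_cstar_algebra"
  assumes sa: "star a = a"
  shows "a * a \<in> positive_cone"
proof (cases "a = 0")
  case True
  then show ?thesis using of_real_mem_positive_cone[of 0] by simp
next
  case False
  define x where "x = (1 / norm a) *\<^sub>R a"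
  have x: "star x = x" "norm x = 1" using sa False by (auto simp: x_def)
  have "norm (x * x) \<le> 1" using norm_mult_ineq[of x x] x by simp
  then obtain s where s: "star s = s" "s * s = 1 - x * x" "\<And>y. y * (x * x) = (x * x) * y \<Longrightarrow> y * s = s * y"
    using exists_sqrt_of_one_minus[of "x * x"] x by (metis star_mult)
  have "s * x = x * s" using s(3)[of x] by (simp add: mult.assoc)
  then have "norm (s * s) \<le> norm (s * s + x * x)" 
    using norm_square_le_norm_sum_squares[OF s(1) x(1)] by simp
  then have "norm (of_real 1 - x * x) \<le> 1" using s(2) by simp
  then have "x * x \<in> positive_cone" by (rule positive_coneI)
  then have "(norm a)\<^sup>2 *\<^sub>R (x * x) \<in> positive_cone" by (simp add: positive_cone_scaleR)
  then show ?thesis using False by (simp add: x_def power2_eq_square)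
qed

text \<open>
  Put \<open>\<epsilon> = \<parallel>a\<^sup>2 + b\<parallel>\<close>. Positivity of \<open>b\<close> makes \<open>\<epsilon> - a\<^sup>2\<close> positive, hence a square \<open>q\<^sup>2\<close> with \<open>q\<close> commuting
  with \<open>a\<close>, and the two squares add up to \<open>\<epsilon>\<close>. Passing from \<open>b\<close> to \<open>\<epsilon> - a\<^sup>2\<close> is what reduces a
  non-commuting pair to the commuting pair \<open>a\<close>, \<open>q\<close>.
\<close>

lemma norm_square_le_norm_add_positive:
  fixes a b :: "'a::unital_cstar_algebra"
  assumes sa: "star a = a" and b: "b \<in> positive_cone"
  shows "norm (a * a) \<le> norm (a * a + b)"
proof -
  obtain t where t: "t \<ge> 0" "norm (of_real t - b) \<le> t" using b by (rule positive_coneE)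
  define \<epsilon> where "\<epsilon> = norm (a * a + b)"
  have "of_real (t + \<epsilon>) - (of_real \<epsilon> - a * a) = (of_real t - b) + (a * a + b)" by simp
  then have "norm (of_real (t + \<epsilon>) - (of_real \<epsilon> - a * a)) \<le> t + \<epsilon>"
    using norm_triangle_ineq[of "of_real t - b" "a * a + b"] t(2) unfolding \<epsilon>_def by (metis add_right_mono order_trans)
  then have "of_real \<epsilon> - a * a \<in> positive_cone" by (rule positive_coneI)
  moreover have "star (of_real \<epsilon> - a * a) = of_real \<epsilon> - a * a" using sa by (simp add: star_mult)
  ultimately obtain q where q: "star q = q" "q * q = of_real \<epsilon> - a * a"
      "\<And>x. x * (of_real \<epsilon> - a * a) = (of_real \<epsilon> - a * a) * x \<Longrightarrow> x * q = q * x"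
    using positive_square_root by blast
  have "a * q = q * a" using q(3)[of a] by (simp add: algebra_simps of_real_def)
  then have "norm (a * a) \<le> norm (a * a + q * q)"
    using norm_square_le_norm_sum_squares sa q(1) by blast
  also have "a * a + q * q = of_real \<epsilon>" using q(2) by simp
  finally show ?thesis by (simp add: \<epsilon>_def)
qed

text \<open>
  Multiplying the two equations gives \<open>x\<^sup>2 + (u v)\<^sup>2 = N\<^sup>2\<close>, a sum of commuting squares. The hypotheses are
  equations between products, so they pass through every homomorphism; this is how contractivity of
  homomorphisms follows.
\<close>

lemma norm_le_of_commuting_square_bounds:
  fixes x :: "'a::unital_cstar_algebra"
  assumes "N \<ge> 0" "star x = x" "star u = u" "star v = v" "u * v = v * u"
    and u: "u * u = of_real N - x" and v: "v * v = of_real N + x"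
  shows "norm x \<le> N"
proof -
  have x: "x = of_real N - u * u" using u by simp
  have "x * u = u * x" unfolding x by (simp add: algebra_simps of_real_def)
  moreover have "x * v = v * x" unfolding x using assms(5)
    by (simp add: algebra_simps of_real_def) (metis mult.assoc)
  ultimately have comm: "x * (u * v) = (u * v) * x" by (metis mult.assoc)
  have sa: "star (u * v) = u * v" using assms by (simp add: star_mult)
  have "(u * v) * (u * v) = (u * u) * (v * v)" using assms(5) by (metis mult.assoc)
  also have "\<dots> = of_real (N\<^sup>2) - x * x"
    unfolding u v by (simp add: algebra_simps of_real_def power2_eq_square)
  finally have "x * x + (u * v) * (u * v) = of_real (N\<^sup>2)" by simp
  then have "norm (x * x) \<le> N\<^sup>2"
    using norm_square_le_norm_sum_squares[OF assms(2) sa comm] by (simp del: of_real_power)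
  then have "(norm x)\<^sup>2 \<le> N\<^sup>2" using cstar_identity[of x] assms by simp
  then show ?thesis using assms(1) by (rule power2_le_imp_le)
qed

lemma commuting_roots_of_bounds:
  fixes x :: "'a::unital_cstar_algebra"
  assumes sa: "star x = x" and "of_real N - x \<in> positive_cone" "of_real N + x \<in> positive_cone"
  obtains u v where "star u = u" "star v = v" "u * v = v * u"
    "u * u = of_real N - x" "v * v = of_real N + x"
proof -
  obtain u where u: "star u = u" "u * u = of_real N - x" 
      "\<And>y. y * (of_real N - x) = (of_real N - x) * y \<Longrightarrow> y * u = u * y"
    using positive_square_root[OF _ assms(2)] sa by (metis star_diff star_of_real)
  obtain v where v: "star v = v" "v * v = of_real N + x" 
      "\<And>y. y * (of_real N + x) = (of_real N + x) * y \<Longrightarrow> y * v = v * y"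
    using positive_square_root[OF _ assms(3)] sa by (metis star_add star_of_real)
  have "x * u = u * x" using u(3)[of x] by (simp add: algebra_simps of_real_def)
  then have "u * v = v * u" using v(3)[of u] by (simp add: algebra_simps of_real_def)
  then show thesis using that u v by blast
qed

lemma norm_le_of_positive_bounds:
  fixes x :: "'a::unital_cstar_algebra"
  assumes "N \<ge> 0" "star x = x" "of_real N - x \<in> positive_cone" "of_real N + x \<in> positive_cone"
  shows "norm x \<le> N"
  by (meson assms commuting_roots_of_bounds norm_le_of_commuting_square_bounds)

section \<open>Homomorphisms\<close>

lemma
  assumes "star_hom f"
  shows star_hom_add: "f (a + b) = f a + f b" and star_hom_mult: "f (a * b) = f a * f b"
    and star_hom_star: "f (star a) = star (f a)" and star_hom_scaleC: "f (z *\<^sub>C a) = z *\<^sub>C f a"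
    and star_hom_scaleR: "f (r *\<^sub>R a) = r *\<^sub>R f a" and star_hom_minus: "f (- a) = - f a"
    and star_hom_diff: "f (a - b) = f a - f b"
proof -
  show add: "f (a + b) = f a + f b" and "f (a * b) = f a * f b" and "f (star a) = star (f a)"
    and "f (z *\<^sub>C a) = z *\<^sub>C f a" for a b z
    using assms by (auto simp: star_hom_def)
  then show scale: "f (r *\<^sub>R a) = r *\<^sub>R f a" for r a by (metis scaleC_of_real)
  then show minus: "f (- a) = - f a" for a using scale[of "-1" a] by simp
  show "f (a - b) = f a - f b" using add[of a "- b"] minus by simp
qed

lemma star_hom_of_real:
  assumes "star_hom f" "f 1 = 1"
  shows "f (of_real r) = of_real r"
  using assms by (simp add: of_real_def star_hom_scaleR)

text \<open>
  For self-adjoint \<open>x\<close> the elements \<open>\<parallel>x\<parallel> - x\<close> and \<open>\<parallel>x\<parallel> + x\<close> are squares of commuting roots, and so are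
  their images. The general case follows from the C*-identity.
\<close>

lemma star_hom_norm_le:
  assumes f: "star_hom f" "f 1 = 1"
  shows "norm (f a) \<le> norm a"
proof -
  have sa: "norm (f x) \<le> norm x" if x: "star x = x" for x
  proof -
    have "of_real (norm x) - x \<in> positive_cone" "of_real (norm x) + x \<in> positive_cone"
      using of_real_add_mem_positive_cone[of x] of_real_add_mem_positive_cone[of "- x"] by auto
    then obtain u v where uv: "star u = u" "star v = v" "u * v = v * u"
      "u * u = of_real (norm x) - x" "v * v = of_real (norm x) + x"
      using x commuting_roots_of_bounds by blast
    show ?thesis
    proof (rule norm_le_of_commuting_square_bounds)
      show "star (f x) = f x" "star (f u) = f u" "star (f v) = f v"
        using star_hom_star[OF f(1)] x uv by metis+
      show "f u * f v = f v * f u" using star_hom_mult[OF f(1)] uv by metis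
      show "f u * f u = of_real (norm x) - f x" "f v * f v = of_real (norm x) + f x"
        using arg_cong[OF uv(4), of f] arg_cong[OF uv(5), of f]
        by (auto simp: star_hom_mult[OF f(1)] star_hom_add[OF f(1)] star_hom_diff[OF f(1)] star_hom_of_real[OF f])
    qed simp
  qed
  have "star (star a * a) = star a * a" by (simp add: star_mult star_star)
  then have "norm (f (star a * a)) \<le> norm (star a * a)" by (rule sa)
  then have "(norm (f a))\<^sup>2 \<le> (norm a)\<^sup>2"
    by (simp add: star_hom_mult[OF f(1)] star_hom_star[OF f(1)] cstar_identity)
  then show ?thesis by (rule power2_le_imp_le) simp
qed

lemma character_one:
  assumes "character \<phi>" shows "\<phi> 1 = 1"
proof -
  have "star_hom \<phi>" using assms by (simp add: character_def)
  moreover obtain a where "\<phi> a \<noteq> 0" using assms by (auto simp: character_def)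
  ultimately show ?thesis using star_hom_mult[of \<phi> a 1] by simp
qed

section \<open>Real and imaginary parts\<close>

lemma scaleC_scaleR_commute: "z *\<^sub>C (r *\<^sub>R a) = r *\<^sub>R (z *\<^sub>C (a::'a::unital_cstar_algebra))"
  by (simp flip: scaleC_of_real add: scaleC_scaleC mult.commute)

lemma scaleC_zero [simp]: "z *\<^sub>C (0::'a::unital_cstar_algebra) = 0"
  using norm_scaleC[of z "0::'a"] by simp

lemma scaleC_Complex: "z *\<^sub>C a = Re z *\<^sub>R a + \<i> *\<^sub>C (Im z *\<^sub>R (a::'a::unital_cstar_algebra))"
proof -
  have "z *\<^sub>C a = (complex_of_real (Re z) + \<i> * complex_of_real (Im z)) *\<^sub>C a"
    by (simp add: complex_eq[symmetric])
  then show ?thesis by (simp only: scaleC_add_left scaleC_scaleC[symmetric] scaleC_of_real)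
qed

definition re_part :: "'a::unital_cstar_algebra \<Rightarrow> 'a" where "re_part a = (1/2) *\<^sub>R (a + star a)"
definition im_part :: "'a::unital_cstar_algebra \<Rightarrow> 'a" where "im_part a = - ((1/2) *\<^sub>R (\<i> *\<^sub>C (a - star a)))"

lemma i_scaleC_i_scaleC: "\<i> *\<^sub>C \<i> *\<^sub>C a = - (a::'a::unital_cstar_algebra)"
  using scaleC_of_real[of "-1" a] by (simp add: scaleC_scaleC)

lemma star_re_part: "star (re_part a) = re_part a"
  by (simp add: re_part_def star_add star_star add.commute)

lemma star_im_part: "star (im_part a) = im_part a"
  by (simp add: im_part_def star_scaleC star_star scaleC_minus_left scaleC_diff_right)

lemma re_part_im_part: "re_part a + \<i> *\<^sub>C im_part a = a"
proof -
  have "\<i> *\<^sub>C im_part a = (1/2) *\<^sub>R (a - star a)"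
    by (simp add: im_part_def scaleC_minus_right scaleC_scaleR_commute i_scaleC_i_scaleC scaleR_diff_right)
  moreover have "(1/2) *\<^sub>R (a + star a) + (1/2) *\<^sub>R (a - star a) = a"
    by (simp add: scaleR_add_right[symmetric] scaleR_2[symmetric])
  ultimately show ?thesis by (simp add: re_part_def)
qed

lemma
  assumes "star x = x" "star y = y"
  shows re_part_eq: "re_part (x + \<i> *\<^sub>C y) = x" and im_part_eq: "im_part (x + \<i> *\<^sub>C y) = y"
proof -
  have s: "star (x + \<i> *\<^sub>C y) = x - \<i> *\<^sub>C y" using assms by (simp add: star_add star_scaleC scaleC_minus_left)
  have "x + \<i> *\<^sub>C y + (x - \<i> *\<^sub>C y) = 2 *\<^sub>R x" by (simp add: scaleR_2)
  then show "re_part (x + \<i> *\<^sub>C y) = x" unfolding re_part_def s by simp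
  have "x + \<i> *\<^sub>C y - (x - \<i> *\<^sub>C y) = 2 *\<^sub>R (\<i> *\<^sub>C y)" by (simp add: scaleR_2)
  then show "im_part (x + \<i> *\<^sub>C y) = y"
    unfolding im_part_def s by (simp add: scaleC_scaleR_commute i_scaleC_i_scaleC)
qed

section \<open>Characters of commutative algebras\<close>

text \<open>
  A character of a commutative algebra is obtained as in the Kadison--Dubois representation theorem:
  a maximal preordering of the self-adjoint part is a total order, and an element is sent to the
  real number that it is infinitesimally close to.
\<close>

definition preordering :: "'a::unital_cstar_algebra set \<Rightarrow> bool" where
  "preordering Q \<longleftrightarrow> Q \<subseteq> {a. star a = a} \<and> {a \<in> positive_cone. star a = a} \<subseteq> Q \<and>
    (\<forall>a\<in>Q. \<forall>b\<in>Q. a + b \<in> Q \<and> a * b \<in> Q) \<and> - 1 \<notin> Q"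

lemma preorderingD:
  assumes "preordering Q"
  shows "a \<in> Q \<Longrightarrow> star a = a" "a \<in> positive_cone \<Longrightarrow> star a = a \<Longrightarrow> a \<in> Q"
    "a \<in> Q \<Longrightarrow> b \<in> Q \<Longrightarrow> a + b \<in> Q" "a \<in> Q \<Longrightarrow> b \<in> Q \<Longrightarrow> a * b \<in> Q" "- 1 \<notin> Q"
  using assms by (auto simp: preordering_def)

lemma preordering_square: "preordering Q \<Longrightarrow> star a = a \<Longrightarrow> a * a \<in> Q"
  by (rule preorderingD(2)) (simp_all add: square_mem_positive_cone star_mult)

lemma preordering_of_real: "preordering Q \<Longrightarrow> r \<ge> 0 \<Longrightarrow> of_real r \<in> Q"
  by (rule preorderingD(2)) (simp_all add: of_real_mem_positive_cone)

lemma preordering_not_negative: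
  assumes Q: "preordering Q" and "r < 0" shows "of_real r \<notin> Q"
proof
  assume "of_real r \<in> Q"
  moreover have "of_real (1 / - r) \<in> Q"
    using assms by (simp add: preordering_of_real del: of_real_divide of_real_minus)
  ultimately have "of_real (1 / - r) * of_real r \<in> Q" using preorderingD(4)[OF Q] by blast
  also have "of_real (1 / - r) * of_real r = (of_real (1 / - r * r) :: 'a)" by (simp only: of_real_mult)
  also have "\<dots> = - 1" using assms by simp
  finally show False using preorderingD(5)[OF Q] by simp
qed

lemma exists_maximal_preordering:
  assumes comm: "\<And>a b :: 'a::unital_cstar_algebra. a * b = b * a"
  obtains Q :: "'a::unital_cstar_algebra set" where "preordering Q" "\<And>R. preordering R \<Longrightarrow> Q \<subseteq> R \<Longrightarrow> R = Q"
proof -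
  let ?P = "{a \<in> positive_cone. star a = a} :: 'a set"
  have "preordering ?P"
    unfolding preordering_def
  proof (intro conjI ballI)
    fix a b assume "a \<in> ?P" "b \<in> ?P"
    then show "a + b \<in> ?P" by (simp add: positive_cone_add star_add)
    obtain u where u: "star u = u" "u * u = a" using \<open>a \<in> ?P\<close> positive_square_root by blast
    obtain v where v: "star v = v" "v * v = b" using \<open>b \<in> ?P\<close> positive_square_root by blast
    have "(u * v) * (u * v) = a * b" using u v comm by (metis mult.assoc)
    moreover have "star (u * v) = u * v" using u v comm by (metis star_mult)
    ultimately show "a * b \<in> ?P" using square_mem_positive_cone[of "u * v"] by (metis (mono_tags) mem_Collect_eq star_mult)
  next
    show "- 1 \<notin> ?P"
    proof
      assume "- 1 \<in> ?P"
      then obtain t where t: "t \<ge> 0" "norm (of_real t - (-1) :: 'a) \<le> t" by (auto elim: positive_coneE)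
      have "norm (of_real t - (-1) :: 'a) = norm (of_real (t + 1) :: 'a)" by simp
      also have "\<dots> = t + 1" using t(1) by (simp only: norm_of_real)
      finally show False using t(2) by simp
    qed
  qed auto
  then have ne: "Collect (preordering :: 'a set \<Rightarrow> bool) \<noteq> {}" by blast
  have chain: "\<Union>\<C> \<in> Collect preordering" if "\<C> \<noteq> {}" "subset.chain (Collect preordering) \<C>" for \<C> :: "'a set set"
  proof -
    have pre: "preordering X" if "X \<in> \<C>" for X using \<open>subset.chain _ _\<close> that by (auto simp: subset.chain_def)
    have lin: "X \<subseteq> Y \<or> Y \<subseteq> X" if "X \<in> \<C>" "Y \<in> \<C>" for X Y
      using \<open>subset.chain _ _\<close> that by (auto simp: subset.chain_def)
    have "a + b \<in> \<Union>\<C> \<and> a * b \<in> \<Union>\<C>" if ab: "a \<in> \<Union>\<C>" "b \<in> \<Union>\<C>" for a b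
    proof -
      obtain X where "X \<in> \<C>" "a \<in> X" "b \<in> X" using ab lin by blast
      then show ?thesis using preorderingD(3,4)[OF pre] by blast
    qed
    moreover have "\<Union>\<C> \<subseteq> {a. star a = a}" "- 1 \<notin> \<Union>\<C>" using preorderingD(1,5)[OF pre] by blast+
    moreover have "?P \<subseteq> \<Union>\<C>" using \<open>\<C> \<noteq> {}\<close> preorderingD(2)[OF pre] by blast
    ultimately show ?thesis by (simp add: preordering_def)
  qed
  show thesis using subset_Zorn_nonempty[OF ne chain] that by blast
qed

text \<open>
  If neither \<open>a\<close> nor \<open>- a\<close> belongs to \<open>Q\<close>, maximality forces \<open>- 1 = p + a q\<close> and \<open>- 1 = p' - a q'\<close> with
  coefficients in \<open>Q\<close>. Then \<open>(1 + p) (1 + p') = - a\<^sup>2 q q'\<close>, which expresses \<open>- 1\<close> as an element of \<open>Q\<close>.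
\<close>

lemma maximal_preordering_total:
  fixes Q :: "'a::unital_cstar_algebra set"
  assumes comm: "\<And>a b :: 'a. a * b = b * a"
    and Q: "preordering Q" and max: "\<And>R. preordering R \<Longrightarrow> Q \<subseteq> R \<Longrightarrow> R = Q"
    and sa: "star a = a"
  shows "a \<in> Q \<or> - a \<in> Q"
proof (rule ccontr)
  assume not: "\<not> (a \<in> Q \<or> - a \<in> Q)"
  have lc: "x * (y * z) = y * (x * z)" for x y z :: 'a by (metis comm mult.assoc)
  have Q0: "0 \<in> Q" and Q1: "1 \<in> Q" using preordering_of_real[OF Q, of 0] preordering_of_real[OF Q, of 1] by auto
  have minus_one: "\<exists>p\<in>Q. \<exists>q\<in>Q. - 1 = p + c * q" if c: "star c = c" "c \<notin> Q" for c
  proof (rule ccontr)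
    assume no: "\<not> ?thesis"
    \<comment> \<open>The preordering generated by \<open>Q\<close> and \<open>c\<close>.\<close>
    define R where "R = {p + c * q | p q. p \<in> Q \<and> q \<in> Q}"
    have "x + y \<in> R \<and> x * y \<in> R" if "x \<in> R" "y \<in> R" for x y
    proof -
      obtain p q p' q' where x: "x = p + c * q" "p \<in> Q" "q \<in> Q" and y: "y = p' + c * q'" "p' \<in> Q" "q' \<in> Q"
        using \<open>x \<in> R\<close> \<open>y \<in> R\<close> by (auto simp: R_def)
      have "x + y = (p + p') + c * (q + q')" by (simp add: x y algebra_simps)
      moreover have "x * y = (p * p' + (c * c) * (q * q')) + c * (p * q' + q * p')"
        by (simp add: x y distrib_left distrib_right mult.assoc lc comm add_ac)
      moreover have "p + p' \<in> Q" "q + q' \<in> Q" "p * p' + (c * c) * (q * q') \<in> Q" "p * q' + q * p' \<in> Q"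
        using x y preordering_square[OF Q c(1)] preorderingD(3,4)[OF Q] by auto
      ultimately show ?thesis unfolding R_def by blast
    qed
    moreover have "R \<subseteq> {x. star x = x}"
      using preorderingD(1)[OF Q] c(1) by (auto simp: R_def star_add star_mult comm)
    moreover have QR: "Q \<subseteq> R"
    proof
      fix p assume "p \<in> Q"
      then show "p \<in> R" unfolding R_def using Q0 by (intro CollectI exI[of _ p] exI[of _ 0]) simp
    qed
    moreover have "- 1 \<notin> R" using no by (auto simp: R_def)
    ultimately have "preordering R" using Q unfolding preordering_def by blast
    then have "R = Q" using max QR by blast
    moreover have "c \<in> R" unfolding R_def using Q0 Q1 by (intro CollectI exI[of _ 0] exI[of _ 1]) simp
    ultimately show False using c by simp
  qed
  obtain p q where pq: "p \<in> Q" "q \<in> Q" "- 1 = p + a * q" using minus_one[of a] sa not by blast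
  obtain p' q' where pq': "p' \<in> Q" "q' \<in> Q" "- 1 = p' + (- a) * q'" using minus_one[of "- a"] sa not by auto
  have "(1 + p) + a * q = 0" using pq(3) by (simp add: add.assoc flip: pq(3))
  then have 1: "1 + p = - (a * q)" by (simp add: eq_neg_iff_add_eq_0)
  have "(1 + p') + (- a) * q' = 0" by (simp only: add.assoc flip: pq'(3)) simp
  then have 2: "1 + p' = a * q'" by simp
  have "(1 + p) * (1 + p') = - ((a * a) * (q * q'))"
    unfolding 1 2 by (simp add: mult.assoc lc[of q a])
  moreover have "p + p' + p * p' + (a * a) * (q * q') = (1 + p) * (1 + p') + (a * a) * (q * q') - 1"
    by (simp add: distrib_left distrib_right)
  ultimately have "- 1 = p + p' + p * p' + (a * a) * (q * q')" by simp
  moreover have "p + p' + p * p' + (a * a) * (q * q') \<in> Q"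
    using pq pq' preordering_square[OF Q sa] preorderingD(3,4)[OF Q] by auto
  ultimately show False using preorderingD(5)[OF Q] by simp
qed

text \<open>
  \<open>a\<close> and \<open>l\<close> differ by an infinitesimal of the preorder. A relation is used instead of the supremum of
  \<open>{r. a - r \<in> Q}\<close> because it is visibly compatible with the algebra operations.
\<close>

definition has_value :: "'a::unital_cstar_algebra set \<Rightarrow> 'a \<Rightarrow> real \<Rightarrow> bool" where
  "has_value Q a l \<longleftrightarrow> (\<forall>e>0. a - of_real l + of_real e \<in> Q \<and> of_real l + of_real e - a \<in> Q)"

lemma has_value_of_real:
  assumes "preordering Q" shows "has_value Q (of_real r) r"
  using preordering_of_real[OF assms] by (simp add: has_value_def)

lemma has_value_unique:
  assumes Q: "preordering Q" and "has_value Q a l" "has_value Q a m"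
  shows "l = m"
proof -
  have le: "m \<le> l" if "has_value Q a l" "has_value Q a m" for l m
  proof (rule ccontr)
    assume "\<not> m \<le> l"
    then have e: "(m - l) / 4 > 0" by simp
    let ?e = "(m - l) / 4"
    have "of_real l + of_real ?e - a \<in> Q" "a - of_real m + of_real ?e \<in> Q"
      using that e unfolding has_value_def by blast+
    then have "(of_real l + of_real ?e - a) + (a - of_real m + of_real ?e) \<in> Q"
      by (rule preorderingD(3)[OF Q])
    also have "(of_real l + of_real ?e - a) + (a - of_real m + of_real ?e) = of_real (l + ?e - m + ?e)"
      by (simp only: of_real_add of_real_diff) simp
    finally show False using preordering_not_negative[OF Q, of "l + ?e - m + ?e"] e by (simp add: field_simps)
  qed
  then show ?thesis using assms by (meson antisym)
qed

lemma has_value_add: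
  assumes Q: "preordering Q" and a: "has_value Q a l" and b: "has_value Q b m"
  shows "has_value Q (a + b) (l + m)"
  unfolding has_value_def
proof (intro allI impI conjI)
  fix e :: real assume "e > 0"
  then have h: "a - of_real l + of_real (e/2) \<in> Q" "of_real l + of_real (e/2) - a \<in> Q"
    "b - of_real m + of_real (e/2) \<in> Q" "of_real m + of_real (e/2) - b \<in> Q"
    using a b unfolding has_value_def by (auto simp del: of_real_divide)
  have e: "of_real e = (of_real (e/2) + of_real (e/2) :: 'a)" by (simp flip: of_real_add)
  show "a + b - of_real (l + m) + of_real e \<in> Q"
    using preorderingD(3)[OF Q h(1,3)] unfolding e by (simp add: algebra_simps del: of_real_divide)
  show "of_real (l + m) + of_real e - (a + b) \<in> Q"
    using preorderingD(3)[OF Q h(2,4)] unfolding e by (simp add: algebra_simps del: of_real_divide)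
qed

lemma has_value_minus: "has_value Q a l \<Longrightarrow> has_value Q (- a) (- l)"
  by (simp add: has_value_def algebra_simps)

lemma has_value_scaleR:
  assumes Q: "preordering Q" and a: "has_value Q a l"
  shows "has_value Q (r *\<^sub>R a) (r * l)"
proof -
  have pos: "has_value Q (r *\<^sub>R a) (r * l)" if "r > 0" for r
    unfolding has_value_def
  proof (intro allI impI conjI)
    fix e :: real assume "e > 0"
    then have "e / r > 0" using that by simp
    then have h: "a - of_real l + of_real (e/r) \<in> Q" "of_real l + of_real (e/r) - a \<in> Q"
      using a unfolding has_value_def by blast+
    have r: "of_real r \<in> Q" using that preordering_of_real[OF Q] by simp
    have e: "of_real e = (of_real r * of_real (e/r) :: 'a)" using that by (simp flip: of_real_mult)
    show "r *\<^sub>R a - of_real (r * l) + of_real e \<in> Q"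
      using preorderingD(4)[OF Q r h(1)] unfolding e
      by (simp add: scaleR_conv_of_real distrib_left right_diff_distrib del: of_real_divide)
    show "of_real (r * l) + of_real e - r *\<^sub>R a \<in> Q"
      using preorderingD(4)[OF Q r h(2)] unfolding e
      by (simp add: scaleR_conv_of_real distrib_left right_diff_distrib del: of_real_divide)
  qed
  consider "r > 0" | "r = 0" | "- r > 0" by linarith
  then show ?thesis
  proof cases
    case 2 then show ?thesis using has_value_of_real[OF Q, of 0] by simp
  next
    case 3 then show ?thesis using has_value_minus[OF pos[OF 3]] by simp
  qed (rule pos)
qed

text \<open>
  From \<open>-\<delta> \<le> b \<le> \<delta>\<close> the product \<open>(b + \<delta>) (\<delta> - b) = \<delta>\<^sup>2 - b\<^sup>2\<close> is in \<open>Q\<close>; take \<open>\<delta>\<close> to be the square root of the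
  required precision. Multiplicativity of values reduces to this case by translation and polarization.
\<close>

lemma has_value_square_zero:
  assumes Q: "preordering Q" and b: "has_value Q b 0" and sa: "star b = b"
  shows "has_value Q (b * b) 0"
  unfolding has_value_def
proof (intro allI impI conjI)
  fix e :: real assume "e > 0"
  then have s: "sqrt e > 0" "e = sqrt e * sqrt e" by auto
  then have h: "b + of_real (sqrt e) \<in> Q" "of_real (sqrt e) - b \<in> Q"
    using b unfolding has_value_def by force+
  show "b * b - of_real 0 + of_real e \<in> Q"
    using preorderingD(3)[OF Q preordering_square[OF Q sa] preordering_of_real[OF Q, of e]] \<open>e > 0\<close> by simp
  have "(b + of_real (sqrt e)) * (of_real (sqrt e) - b) = of_real (sqrt e * sqrt e) - b * b"
    by (simp add: algebra_simps of_real_def del: real_sqrt_mult_self)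
  then show "of_real 0 + of_real e - b * b \<in> Q"
    using preorderingD(4)[OF Q h] s(2) by simp
qed

lemma has_value_square:
  assumes Q: "preordering Q" and a: "has_value Q a l" and sa: "star a = a"
  shows "has_value Q (a * a) (l * l)"
proof -
  let ?b = "a - of_real l"
  have "has_value Q ?b 0"
    using has_value_add[OF Q a has_value_of_real[OF Q, of "- l"]] by simp
  then have "has_value Q (?b * ?b) 0" using has_value_square_zero[OF Q] sa by simp
  then have "has_value Q (?b * ?b + (2 * l) *\<^sub>R a + of_real (- l * l)) (0 + (2 * l) * l + - l * l)"
    by (intro has_value_add[OF Q] has_value_scaleR[OF Q] has_value_of_real[OF Q] a)
  moreover have "?b * ?b + (2 * l) *\<^sub>R a + of_real (- l * l) = a * a"
    by (simp add: algebra_simps of_real_def scaleR_2[symmetric])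
  ultimately show ?thesis by (simp add: algebra_simps)
qed

lemma has_value_mult:
  assumes Q: "preordering Q" and "has_value Q a l" "has_value Q b m" "star a = a" "star b = b" "a * b = b * a"
  shows "has_value Q (a * b) (l * m)"
proof -
  have sum: "has_value Q ((a + b) * (a + b)) ((l + m) * (l + m))"
    using assms by (intro has_value_square has_value_add) (auto simp: star_add)
  have "has_value Q (a + - b) (l + - m)"
    using assms by (intro has_value_add has_value_minus) auto
  then have "has_value Q ((a + - b) * (a + - b)) ((l + - m) * (l + - m))"
    using assms by (intro has_value_square) (auto simp: star_add)
  from has_value_scaleR[OF Q has_value_add[OF Q sum has_value_minus[OF this]], of "1/4"]
  have "has_value Q ((1/4) *\<^sub>R ((a + b) * (a + b) + - ((a + - b) * (a + - b))))
      (1/4 * ((l + m) * (l + m) + - ((l + - m) * (l + - m))))" .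
  moreover have "(a + b) * (a + b) + - ((a + - b) * (a + - b)) = 4 *\<^sub>R (a * b)"
    using assms(6) scaleR_add_left[of 2 2 "a * b"] by (simp add: algebra_simps scaleR_2)
  moreover have "1/4 * ((l + m) * (l + m) + - ((l + - m) * (l + - m))) = l * m"
    by (simp add: algebra_simps)
  ultimately show ?thesis by simp
qed

text \<open>
  The value is a Dedekind cut, bounded because \<open>\<parallel>a\<parallel> - a\<close> and \<open>\<parallel>a\<parallel> + a\<close> are positive; totality of the order
  gives the upper estimate.
\<close>

lemma exists_has_value:
  fixes Q :: "'a::unital_cstar_algebra set"
  assumes Q: "preordering Q" and total: "\<And>a. star a = a \<Longrightarrow> a \<in> Q \<or> - a \<in> Q"
    and sa: "star a = a"
  obtains l where "has_value Q a l"
proof -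
  define S where "S = {r. a - of_real r \<in> Q}"
  have upper: "of_real (norm a) - a \<in> Q" and lower: "a - of_real (- norm a) \<in> Q"
    using preorderingD(2)[OF Q of_real_add_mem_positive_cone[of a]]
      preorderingD(2)[OF Q of_real_add_mem_positive_cone[of "- a"]] sa
    by (auto simp: star_add add.commute)
  have ne: "- norm a \<in> S" using lower by (simp add: S_def)
  have bound: "r \<le> norm a" if "r \<in> S" for r
  proof (rule ccontr)
    assume "\<not> r \<le> norm a"
    have "(of_real (norm a) - a) + (a - of_real r) \<in> Q"
      using preorderingD(3)[OF Q upper, of "a - of_real r"] that unfolding S_def by blast
    also have "(of_real (norm a) - a) + (a - of_real r) = of_real (norm a - r)" by simp
    finally show False using preordering_not_negative[OF Q, of "norm a - r"] \<open>\<not> r \<le> norm a\<close> by simp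
  qed
  have bdd: "bdd_above S" using bound by (rule bdd_aboveI)
  have "has_value Q a (Sup S)"
    unfolding has_value_def
  proof (intro allI impI conjI)
    fix e :: real assume e: "e > 0"
    then have "Sup S - e < Sup S" by simp
    then obtain r where r: "r \<in> S" "Sup S - e < r"
      using ne less_cSup_iff[OF _ bdd] by blast
    have "(a - of_real r) + of_real (r - Sup S + e) \<in> Q"
      using r preordering_of_real[OF Q, of "r - Sup S + e"]
      by (intro preorderingD(3)[OF Q]) (auto simp: S_def)
    then show "a - of_real (Sup S) + of_real e \<in> Q" by (simp add: algebra_simps)
    show "of_real (Sup S) + of_real e - a \<in> Q"
    proof (rule ccontr)
      assume "of_real (Sup S) + of_real e - a \<notin> Q"
      then have "- (of_real (Sup S) + of_real e - a) \<in> Q"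
        using total[of "of_real (Sup S) + of_real e - a"] sa by (auto simp: star_add)
      then have "Sup S + e \<in> S" by (simp add: S_def algebra_simps)
      then show False using cSup_upper[OF _ bdd] e by fastforce
    qed
  qed
  then show thesis by (rule that)
qed

theorem exists_character_if_commutative:
  assumes comm: "\<And>a b :: 'a::unital_cstar_algebra. a * b = b * a"
  shows "\<exists>\<phi> :: 'a \<Rightarrow> complex. character \<phi>"
proof -
  obtain Q :: "'a set" where Q: "preordering Q" and max: "\<And>R. preordering R \<Longrightarrow> Q \<subseteq> R \<Longrightarrow> R = Q"
    using exists_maximal_preordering[OF comm] by blast
  define v where "v a = (SOME l. has_value Q a l)" for a
  have v: "has_value Q a (v a)" if "star a = a" for a
    unfolding v_def using exists_has_value[OF Q maximal_preordering_total[OF comm Q max] that]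
    by (metis someI_ex)
  have vI: "v a = l" if "has_value Q a l" "star a = a" for a l
    using has_value_unique[OF Q v that(1)] that by simp
  define \<phi> where "\<phi> a = Complex (v (re_part a)) (v (im_part a))" for a
  have \<phi>: "\<phi> c = Complex l m"
    if "c = x + \<i> *\<^sub>C y" "star x = x" "star y = y" "has_value Q x l" "has_value Q y m" for c x y l m
    using that by (simp add: \<phi>_def re_part_eq im_part_eq vI)
  have dec: "\<exists>x y l m. a = x + \<i> *\<^sub>C y \<and> star x = x \<and> star y = y \<and> has_value Q x l \<and> has_value Q y m" for a
    using re_part_im_part[of a] star_re_part[of a] star_im_part[of a] v by metis
  have "star_hom \<phi>"
    unfolding star_hom_def
  proof (intro conjI allI)
    fix a b :: 'a and z :: complex
    obtain x y l m where a: "a = x + \<i> *\<^sub>C y" "star x = x" "star y = y" "has_value Q x l" "has_value Q y m"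
      using dec by blast
    obtain x' y' l' m' where b: "b = x' + \<i> *\<^sub>C y'" "star x' = x'" "star y' = y'" "has_value Q x' l'" "has_value Q y' m'"
      using dec by blast
    have pa: "\<phi> a = Complex l m" and pb: "\<phi> b = Complex l' m'" using \<phi>[OF a] \<phi>[OF b] .
    have "a + b = (x + x') + \<i> *\<^sub>C (y + y')" by (simp add: a(1) b(1) scaleC_add_right)
    then have "\<phi> (a + b) = Complex (l + l') (m + m')"
      by (rule \<phi>) (simp_all add: a b star_add has_value_add[OF Q])
    then show "\<phi> (a + b) = \<phi> a + \<phi> b" by (simp add: pa pb complex_eq_iff)
    have "a * b = (x * x' + - (y * y')) + \<i> *\<^sub>C (x * y' + y * x')"
      by (simp add: a(1) b(1) distrib_left distrib_right mult_scaleC_left mult_scaleC_right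
          scaleC_add_right i_scaleC_i_scaleC add_ac)
    moreover have "has_value Q (x * x' + - (y * y')) (l * l' + - (m * m'))" "has_value Q (x * y' + y * x') (l * m' + m * l')"
      using a b comm by (intro has_value_add[OF Q] has_value_minus has_value_mult[OF Q]; simp)+
    ultimately have "\<phi> (a * b) = Complex (l * l' + - (m * m')) (l * m' + m * l')"
      by (intro \<phi>[of "a * b"]) (simp_all add: a(2,3) b(2,3) star_add star_mult comm)
    then show "\<phi> (a * b) = \<phi> a * \<phi> b" by (simp add: pa pb complex_eq_iff)
    have "star a = x + \<i> *\<^sub>C (- y)"
      by (simp add: a star_add star_scaleC scaleC_minus_left scaleC_minus_right)
    then have "\<phi> (star a) = Complex l (- m)" by (rule \<phi>) (simp_all add: a has_value_minus)
    then show "\<phi> (star a) = star (\<phi> a)" by (simp add: pa star_complex_def complex_eq_iff)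
    have "z *\<^sub>C a = (Re z *\<^sub>R x + - (Im z *\<^sub>R y)) + \<i> *\<^sub>C (Re z *\<^sub>R y + Im z *\<^sub>R x)"
      by (subst scaleC_Complex) (simp add: a(1) scaleR_add_right scaleC_add_right
          scaleC_scaleR_commute i_scaleC_i_scaleC add_ac)
    moreover have "has_value Q (Re z *\<^sub>R x + - (Im z *\<^sub>R y)) (Re z * l + - (Im z * m))"
      "has_value Q (Re z *\<^sub>R y + Im z *\<^sub>R x) (Re z * m + Im z * l)"
      using a by (intro has_value_add[OF Q] has_value_minus has_value_scaleR[OF Q]; simp)+
    ultimately have "\<phi> (z *\<^sub>C a) = Complex (Re z * l + - (Im z * m)) (Re z * m + Im z * l)"
      by (intro \<phi>[of "z *\<^sub>C a"]) (simp_all add: a(2,3) star_add)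
    then show "\<phi> (z *\<^sub>C a) = z *\<^sub>C \<phi> a" by (simp add: pa scaleC_complex_def complex_eq_iff)
  qed
  moreover have "\<phi> (1 + \<i> *\<^sub>C 0) = Complex 1 0"
    using has_value_of_real[OF Q, of 1] has_value_of_real[OF Q, of 0] by (intro \<phi>) auto
  then have "\<phi> 1 \<noteq> 0" by (simp add: complex_eq_iff)
  ultimately show ?thesis unfolding character_def by blast
qed

section \<open>Averaging over the group\<close>

text \<open>
  Mazur's theorem: the hull stays within any given distance of the hull of a finite net, and the latter
  is compact.
\<close>

lemma compact_closure_convex_hull:
  fixes S :: "'a::banach set"
  assumes "compact S"
  shows "compact (closure (convex hull S))"
  unfolding compact_eq_totally_bounded
proof (intro conjI allI impI)
  show "complete (closure (convex hull S))" by (simp add: complete_eq_closed)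
  fix e :: real assume "e > 0"
  then have e: "e/3 > 0" by simp
  obtain F where F: "finite F" "S \<subseteq> (\<Union>x\<in>F. ball x (e/3))"
    using assms e unfolding compact_eq_totally_bounded by blast
  have "compact (convex hull F)" using F(1) by (rule finite_imp_compact_convex_hull)
  then obtain K where K: "finite K" "convex hull F \<subseteq> (\<Union>x\<in>K. ball x (e/3))"
    using e unfolding compact_eq_totally_bounded by blast
  define N where "N = (\<Union>x\<in>convex hull F. \<Union>y\<in>ball 0 (e/3). {x + y})"
  have "convex N" unfolding N_def by (intro convex_sums convex_convex_hull convex_ball)
  moreover have "S \<subseteq> N"
  proof
    fix s assume "s \<in> S"
    then obtain x where "x \<in> F" "dist x s < e/3" using F(2) by auto
    then show "s \<in> N"
      unfolding N_def using hull_inc[of x F convex]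
      by (intro UN_I[of x] UN_I[of "s - x"]) (auto simp: dist_norm norm_minus_commute)
  qed
  ultimately have N: "convex hull S \<subseteq> N" by (simp add: hull_minimal)
  have "y \<in> (\<Union>x\<in>K. ball x e)" if y: "y \<in> closure (convex hull S)" for y
  proof -
    obtain y' where y': "y' \<in> convex hull S" "dist y' y < e/3"
      using y e unfolding closure_approachable by blast
    obtain x where x: "x \<in> convex hull F" "dist x y' < e/3"
      using y'(1) N unfolding N_def by (auto simp: dist_norm)
    obtain k where k: "k \<in> K" "dist k x < e/3" using x(1) K(2) by auto
    have "dist k y < e" using dist_triangle[of k y x] dist_triangle[of x y y'] k x y' by linarith
    then show ?thesis using k by auto
  qed
  then show "\<exists>k. finite k \<and> closure (convex hull S) \<subseteq> (\<Union>x\<in>k. ball x e)" using K(1) by blast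
qed

lemma positive_cone_sum:
  "finite I \<Longrightarrow> (\<And>i. i \<in> I \<Longrightarrow> f i \<in> positive_cone) \<Longrightarrow> sum f I \<in> positive_cone"
  by (induction I rule: finite_induct)
    (use of_real_mem_positive_cone[of 0] in \<open>auto intro: positive_cone_add\<close>)

lemma star_hom_positive_cone:
  assumes f: "star_hom f" "f 1 = 1" and b: "b \<in> positive_cone"
  shows "f b \<in> positive_cone"
proof -
  obtain t where "norm (of_real t - b) \<le> t" using b by (auto simp: positive_cone_def)
  then have "norm (f (of_real t - b)) \<le> t" using star_hom_norm_le[OF f] order_trans by blast
  then show ?thesis by (intro positive_coneI[of t]) (simp add: star_hom_diff[OF f(1)] star_hom_of_real[OF f])
qed

lemma star_hom_bounded_linear:
  assumes "star_hom f" "f 1 = 1"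
  shows "bounded_linear f"
  using star_hom_norm_le[OF assms]
  by (intro bounded_linear_intro[of _ 1]) (simp_all add: star_hom_add star_hom_scaleR assms)

context ergodic_action
begin

lemma
  assumes g: "g \<in> carrier G"
  shows star_hom_action: "star_hom (\<alpha> g)" and bij_action: "bij (\<alpha> g)"
  using hom_in_carrier[OF action g] by (auto simp: star_Aut_def)

lemma action_mult: "g \<in> carrier G \<Longrightarrow> h \<in> carrier G \<Longrightarrow> \<alpha> (g \<otimes>\<^bsub>G\<^esub> h) c = \<alpha> g (\<alpha> h c)"
  using hom_mult[OF action, of g h] by (simp add: star_Aut_def)

lemma action_one: "\<alpha> \<one>\<^bsub>G\<^esub> c = c"
proof -
  have "\<alpha> \<one>\<^bsub>G\<^esub> (\<alpha> \<one>\<^bsub>G\<^esub> c) = \<alpha> \<one>\<^bsub>G\<^esub> c" using action_mult[of "\<one>\<^bsub>G\<^esub>" "\<one>\<^bsub>G\<^esub>" c] by simp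
  then show ?thesis using bij_action[of "\<one>\<^bsub>G\<^esub>"] by (simp add: bij_def inj_eq)
qed

lemma action_inv_left: "g \<in> carrier G \<Longrightarrow> \<alpha> (inv\<^bsub>G\<^esub> g) (\<alpha> g c) = c"
  using action_mult[of "inv\<^bsub>G\<^esub> g" g c] by (simp add: action_one)

lemma action_unit: 
  assumes g: "g \<in> carrier G" shows "\<alpha> g 1 = 1"
proof -
  obtain x where "\<alpha> g x = 1" using bij_action[OF g] by (metis bij_pointE)
  then show ?thesis using star_hom_mult[OF star_hom_action[OF g], of 1 x] by simp
qed

lemma norm_action:
  assumes g: "g \<in> carrier G" shows "norm (\<alpha> g c) = norm c"
proof (rule antisym)
  show "norm (\<alpha> g c) \<le> norm c" using g by (intro star_hom_norm_le star_hom_action action_unit)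
  have "norm (\<alpha> (inv\<^bsub>G\<^esub> g) (\<alpha> g c)) \<le> norm (\<alpha> g c)"
    using g by (intro star_hom_norm_le star_hom_action action_unit) auto
  then show "norm c \<le> norm (\<alpha> g c)" using g by (simp add: action_inv_left)
qed

lemma bounded_linear_action: "g \<in> carrier G \<Longrightarrow> bounded_linear (\<alpha> g)"
  by (intro star_hom_bounded_linear star_hom_action action_unit)

lemma norm_action_diff:
  "g \<in> carrier G \<Longrightarrow> norm (\<alpha> g a - \<alpha> g b) = norm (a - b)"
  by (metis norm_action star_hom_action star_hom_diff)

definition orbit :: "'c \<Rightarrow> 'c set" where "orbit c = (\<lambda>g. \<alpha> g c) ` carrier G"

lemma self_mem_orbit: "c \<in> orbit c"
  unfolding orbit_def using action_one[of c] by (metis image_eqI one_closed)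

lemma compact_orbit: "compact (orbit c)"
proof -
  have "compactin T (carrier G)" using compact topspace_eq by (simp add: compact_space_def)
  from image_compactin[OF this strongly_continuous] show ?thesis
    by (simp add: orbit_def)
qed

text \<open>
  The maps \<open>\<alpha> g\<close> are isometries that permute the orbit, so displacements from the base point control
  all distances in the orbit.
\<close>

lemma orbit_diameter:
  assumes "\<And>g. g \<in> carrier G \<Longrightarrow> norm (\<alpha> g y - y) \<le> d" "a \<in> orbit y" "b \<in> orbit y"
  shows "norm (a - b) \<le> d"
proof -
  obtain g h where gh: "g \<in> carrier G" "h \<in> carrier G" "a = \<alpha> g y" "b = \<alpha> h y"
    using assms by (auto simp: orbit_def)
  have "norm (a - b) = norm (\<alpha> (inv\<^bsub>G\<^esub> h) a - \<alpha> (inv\<^bsub>G\<^esub> h) b)"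
    using gh by (simp add: norm_action_diff)
  also have "\<dots> = norm (\<alpha> (inv\<^bsub>G\<^esub> h \<otimes>\<^bsub>G\<^esub> g) y - y)"
    using gh by (simp add: action_inv_left action_mult)
  also have "\<dots> \<le> d" using gh by (intro assms) auto
  finally show ?thesis .
qed

lemma action_orbit_subset: "g \<in> carrier G \<Longrightarrow> \<alpha> g ` orbit c \<subseteq> orbit c"
  by (auto simp: orbit_def action_mult[symmetric])

lemma action_closed_hull_subset:
  assumes g: "g \<in> carrier G"
  shows "\<alpha> g ` closure (convex hull orbit c) \<subseteq> closure (convex hull orbit c)"
proof -
  have "\<alpha> g ` (convex hull orbit c) = convex hull (\<alpha> g ` orbit c)"
    using bounded_linear_action[OF g] by (simp add: convex_hull_linear_image bounded_linear.linear)
  also have "\<dots> \<subseteq> convex hull orbit c" by (intro hull_mono action_orbit_subset g)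
  finally have "closure (\<alpha> g ` (convex hull orbit c)) \<subseteq> closure (convex hull orbit c)"
    by (rule closure_mono)
  then show ?thesis
    using closure_bounded_linear_image_subset[OF bounded_linear_action[OF g]] by blast
qed

text \<open>
  The mean \<open>z\<close> of a finite \<open>d/2\<close>-net of the orbit is closer than \<open>d\<close> to each point of the orbit, by a
  uniform margin, since one of its summands is within \<open>d/2\<close>. Moreover \<open>\<alpha> g z\<close> is again a mean of orbit points, whence
  \<open>z\<close> is moved by less than \<open>d\<close>.
\<close>

lemma exists_smaller_orbit:
  assumes d: "d > 0" and bound: "\<And>g. g \<in> carrier G \<Longrightarrow> norm (\<alpha> g y - y) \<le> d"
  obtains z r where "z \<in> convex hull orbit y" "r < d" "\<And>g. g \<in> carrier G \<Longrightarrow> norm (\<alpha> g z - z) \<le> r"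
proof -
  have "orbit y \<subseteq> (\<Union>w\<in>orbit y. ball w (d/2))" using d by auto
  then obtain F where F: "F \<subseteq> orbit y" "finite F" "orbit y \<subseteq> (\<Union>w\<in>F. ball w (d/2))"
    using compactE_image[OF compact_orbit, of "orbit y" "\<lambda>w. ball w (d/2)"] by (metis open_ball)
  define k where "k = real (card F)"
  have "F \<noteq> {}" using F(3) self_mem_orbit by auto
  then have k: "k > 0" using F(2) by (simp add: k_def card_gt_0_iff)
  have one: "(\<Sum>w\<in>F. 1/k) = 1" using k by (simp add: k_def)
  define z where "z = (\<Sum>w\<in>F. (1/k) *\<^sub>R w)"
  define r where "r = d - d / (2 * k)"
  have z: "z \<in> convex hull orbit y"
    unfolding z_def using F(1,2) one k
    by (intro convex_sum convex_convex_hull) (auto intro: hull_inc)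
  have avg: "(\<Sum>w\<in>F. (1/k) *\<^sub>R f w) - x = (\<Sum>w\<in>F. (1/k) *\<^sub>R (f w - x))" for f :: "'c \<Rightarrow> 'c" and x
  proof -
    have "(\<Sum>w\<in>F. (1/k) *\<^sub>R (f w - x)) = (\<Sum>w\<in>F. (1/k) *\<^sub>R f w) - (\<Sum>w\<in>F. 1/k) *\<^sub>R x"
      by (simp only: scaleR_diff_right sum_subtractf scaleR_sum_left)
    then show ?thesis by (simp only: one) simp
  qed
  have near: "norm (z - x) \<le> r" if x: "x \<in> orbit y" for x
  proof -
    obtain v where v: "v \<in> F" "norm (v - x) < d/2" using F(3) x by (auto simp: dist_norm)
    have "z - x = (\<Sum>w\<in>F. (1/k) *\<^sub>R (w - x))" unfolding z_def by (rule avg)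
    also have "norm \<dots> \<le> (\<Sum>w\<in>F. norm ((1/k) *\<^sub>R (w - x)))" by (rule norm_sum)
    also have "\<dots> = (\<Sum>w\<in>F. norm (w - x)) / k" using k by (simp add: sum_divide_distrib)
    also have "(\<Sum>w\<in>F. norm (w - x)) = norm (v - x) + (\<Sum>w\<in>F - {v}. norm (w - x))"
      using F(2) v(1) by (rule sum.remove)
    also have "(\<Sum>w\<in>F - {v}. norm (w - x)) \<le> of_nat (card (F - {v})) * d"
      using F(1) by (intro sum_bounded_above orbit_diameter[OF bound _ x]) auto
    also have "of_nat (card (F - {v})) = k - 1" using F(2) v(1) k by (simp add: k_def card_Diff_singleton of_nat_diff)
    finally have "norm (z - x) \<le> (norm (v - x) + (k - 1) * d) / k" using k by (simp add: divide_right_mono)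
    also have "\<dots> \<le> (d/2 + (k - 1) * d) / k" using v k by (intro divide_right_mono) auto
    also have "\<dots> = r" using k by (simp add: r_def field_simps)
    finally show ?thesis .
  qed
  have "norm (\<alpha> g z - z) \<le> r" if g: "g \<in> carrier G" for g
  proof -
    have "\<alpha> g z = (\<Sum>w\<in>F. (1/k) *\<^sub>R \<alpha> g w)"
      unfolding z_def using bounded_linear.linear[OF bounded_linear_action[OF g]] by (simp add: linear_sum linear_cmul)
    then have "\<alpha> g z - z = (\<Sum>w\<in>F. (1/k) *\<^sub>R (\<alpha> g w - z))" by (simp only: avg)
    also have "norm \<dots> \<le> (\<Sum>w\<in>F. norm ((1/k) *\<^sub>R (\<alpha> g w - z)))" by (rule norm_sum)
    also have "\<dots> \<le> (\<Sum>w\<in>F. (1/k) * r)"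
    proof (rule sum_mono)
      fix w assume "w \<in> F"
      then have "\<alpha> g w \<in> orbit y" using F(1) action_orbit_subset[OF g] by blast
      then show "norm ((1/k) *\<^sub>R (\<alpha> g w - z)) \<le> (1/k) * r"
        using near[of "\<alpha> g w"] k by (simp add: norm_minus_commute[of "\<alpha> g w" z] divide_right_mono)
    qed
    also have "\<dots> = r" using one by (simp only: sum_distrib_right[symmetric] mult_1_left)
    finally show ?thesis .
  qed
  moreover have "r < d" using d k by (simp add: r_def)
  ultimately show thesis using that z by blast
qed

text \<open>
  The point of the compact convex hull that is moved least must be fixed, by
  \<open>exists_smaller_orbit\<close>; ergodicity then says that it is a scalar. This point is the Haar mean of the
  orbit.
\<close>

theorem exists_scalar_in_closed_hull:
  obtains z :: complex where "z *\<^sub>C 1 \<in> closure (convex hull orbit c)"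
proof -
  let ?H = "closure (convex hull orbit c)"
  have H: "compact ?H" "convex ?H" "?H \<noteq> {}"
    using compact_closure_convex_hull[OF compact_orbit] self_mem_orbit[of c] by auto
  define f where "f y = (SUP g\<in>carrier G. norm (\<alpha> g y - y))" for y
  have bdd: "bdd_above ((\<lambda>g. norm (\<alpha> g y - y)) ` carrier G)" for y
  proof (rule bdd_aboveI2)
    fix g assume "g \<in> carrier G"
    then show "norm (\<alpha> g y - y) \<le> norm y + norm y" using norm_triangle_ineq4[of "\<alpha> g y" y] by (simp add: norm_action)
  qed
  have upper: "norm (\<alpha> g y - y) \<le> f y" if "g \<in> carrier G" for g y
    unfolding f_def using that bdd by (rule cSUP_upper)
  have least: "f y \<le> r" if "\<And>g. g \<in> carrier G \<Longrightarrow> norm (\<alpha> g y - y) \<le> r" for y r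
    unfolding f_def using that by (intro cSUP_least) auto
  have lip: "f x \<le> f y + 2 * norm (x - y)" for x y
  proof (rule least)
    fix g assume g: "g \<in> carrier G"
    have "\<alpha> g x - x = (\<alpha> g x - \<alpha> g y) + (\<alpha> g y - y) + (y - x)" by simp
    then have "norm (\<alpha> g x - x) \<le> norm (\<alpha> g x - \<alpha> g y) + norm (\<alpha> g y - y) + norm (y - x)"
      by (metis norm_triangle_ineq norm_triangle_le add_right_mono)
    then show "norm (\<alpha> g x - x) \<le> f y + 2 * norm (x - y)"
      using upper[OF g, of y] by (simp add: norm_action_diff[OF g] norm_minus_commute)
  qed
  have "continuous_on ?H f"
    unfolding continuous_on_iff
  proof (intro ballI allI impI)
    fix x and e :: real assume "e > 0"
    have "dist (f x') (f x) < e" if "dist x' x < e/2" for x'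
      using lip[of x x'] lip[of x' x] that by (simp add: dist_norm norm_minus_commute)
    then show "\<exists>d>0. \<forall>x'\<in>?H. dist x' x < d \<longrightarrow> dist (f x') (f x) < e"
      using \<open>e > 0\<close> by (intro exI[of _ "e/2"]) auto
  qed
  then obtain y where y: "y \<in> ?H" and min: "\<And>x. x \<in> ?H \<Longrightarrow> f y \<le> f x"
    using continuous_attains_inf[OF H(1,3)] by blast
  have "f y \<le> 0"
  proof (rule ccontr)
    assume "\<not> f y \<le> 0"
    then have "f y > 0" by simp
    from exists_smaller_orbit[OF this upper]
    obtain z r where z: "z \<in> convex hull orbit y" "r < f y" "\<And>g. g \<in> carrier G \<Longrightarrow> norm (\<alpha> g z - z) \<le> r"
      by blast
    have "orbit y \<subseteq> ?H" using y action_closed_hull_subset by (auto simp: orbit_def)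
    then have "z \<in> ?H" using z(1) H(2) by (meson hull_minimal subsetD)
    then have "f y \<le> f z" by (rule min)
    moreover have "f z \<le> r" using z(3) by (rule least)
    ultimately show False using z(2) by simp
  qed
  then have "norm (\<alpha> g y - y) \<le> 0" if "g \<in> carrier G" for g
    using upper[OF that, of y] by linarith
  then have "\<forall>g\<in>carrier G. \<alpha> g y = y" by simp
  then obtain z where "y = z *\<^sub>C 1" using ergodic by blast
  then show thesis using that y by blast
qed

text \<open>
  This is the faithfulness of the mean. Cover the orbit of \<open>c\<^sup>2\<close> by finitely many balls of radius \<open>\<delta>\<close> around
  \<open>\<alpha> k (c\<^sup>2)\<close>, \<open>k \<in> K\<close>. For each \<open>y\<close> in the orbit, one of the elements \<open>\<alpha> (k\<^sup>-\<^sup>1) y\<close> is \<open>\<delta>\<close>-close to \<open>c\<^sup>2\<close> while the others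
  are positive, so their sum dominates \<open>c\<^sup>2\<close> up to \<open>\<delta>\<close>. This condition is convex in \<open>y\<close> and therefore holds
  throughout the convex hull; but at points of the hull near \<open>0\<close> the sum is small.
\<close>

lemma zero_if_zero_in_closed_hull:
  assumes sa: "star c = c" and zero: "0 \<in> closure (convex hull orbit (c * c))"
  shows "c = 0"
proof (rule ccontr)
  assume "c \<noteq> 0"
  define \<delta> where "\<delta> = norm (c * c) / 4"
  have \<delta>: "\<delta> > 0" using \<open>c \<noteq> 0\<close> cstar_identity[of c] sa by (simp add: \<delta>_def)
  have "orbit (c * c) \<subseteq> (\<Union>k\<in>carrier G. ball (\<alpha> k (c * c)) \<delta>)" using \<delta> by (auto simp: orbit_def)
  then obtain K where K: "K \<subseteq> carrier G" "finite K" "orbit (c * c) \<subseteq> (\<Union>k\<in>K. ball (\<alpha> k (c * c)) \<delta>)"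
    using compactE_image[OF compact_orbit, of "carrier G" "\<lambda>k. ball (\<alpha> k (c * c)) \<delta>"] by (metis open_ball)
  have inv: "inv\<^bsub>G\<^esub> k \<in> carrier G" if "k \<in> K" for k using K(1) that by auto
  define P where "P y = (\<Sum>k\<in>K. \<alpha> (inv\<^bsub>G\<^esub> k) y)" for y
  have "linear P"
    unfolding P_def using inv
    by (intro linear_compose_sum ballI bounded_linear.linear bounded_linear_action)
  \<comment> \<open>The elements that dominate \<open>c\<^sup>2\<close> up to an error of norm at most \<open>\<delta>\<close>.\<close>
  define E where "E = {y. \<exists>p\<in>positive_cone. norm (y - c * c - p) \<le> \<delta>}"
  have "convex E"
  proof (rule convexI)
    fix x y and u v :: real assume "x \<in> E" "y \<in> E" and uv: "0 \<le> u" "0 \<le> v" "u + v = 1"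
    then obtain p q where p: "p \<in> positive_cone" "norm (x - c * c - p) \<le> \<delta>"
      and q: "q \<in> positive_cone" "norm (y - c * c - q) \<le> \<delta>" by (auto simp: E_def)
    have "u *\<^sub>R (c * c) + v *\<^sub>R (c * c) = c * c" using uv by (simp flip: scaleR_add_left)
    then have "(u *\<^sub>R x + v *\<^sub>R y) - c * c - (u *\<^sub>R p + v *\<^sub>R q) = u *\<^sub>R (x - c * c - p) + v *\<^sub>R (y - c * c - q)"
      by (simp add: scaleR_diff_right algebra_simps)
    also have "norm \<dots> \<le> u * norm (x - c * c - p) + v * norm (y - c * c - q)"
      using norm_triangle_ineq[of "u *\<^sub>R (x - c * c - p)" "v *\<^sub>R (y - c * c - q)"] uv by simp
    also have "\<dots> \<le> u * \<delta> + v * \<delta>" using p q uv by (intro add_mono mult_left_mono) auto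
    also have "\<dots> = \<delta>" using uv by (simp flip: distrib_right)
    finally show "u *\<^sub>R x + v *\<^sub>R y \<in> E"
      unfolding E_def using p q uv positive_cone_add positive_cone_scaleR by blast
  qed
  have "P y \<in> E" if y: "y \<in> orbit (c * c)" for y
  proof -
    obtain g where g: "g \<in> carrier G" "y = \<alpha> g (c * c)" using y by (auto simp: orbit_def)
    obtain k where k: "k \<in> K" "norm (\<alpha> k (c * c) - y) < \<delta>" using K(3) y by (auto simp: dist_norm)
    have "norm (\<alpha> (inv\<^bsub>G\<^esub> k) (\<alpha> k (c * c)) - \<alpha> (inv\<^bsub>G\<^esub> k) y) < \<delta>"
      using k inv by (simp add: norm_action_diff)
    then have near: "norm (\<alpha> (inv\<^bsub>G\<^esub> k) y - c * c) \<le> \<delta>"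
      using k K(1) by (simp add: action_inv_left norm_minus_commute subset_iff)
    have pos: "\<alpha> h y \<in> positive_cone" if h: "h \<in> carrier G" for h
    proof -
      have "star (\<alpha> h (\<alpha> g c)) = \<alpha> h (\<alpha> g c)"
        using sa h g(1) by (metis star_hom_action star_hom_star)
      moreover have "\<alpha> h y = \<alpha> h (\<alpha> g c) * \<alpha> h (\<alpha> g c)"
        using h g by (simp add: star_hom_mult[OF star_hom_action])
      ultimately show ?thesis by (simp add: square_mem_positive_cone)
    qed
    define p where "p = (\<Sum>k\<in>K - {k}. \<alpha> (inv\<^bsub>G\<^esub> k) y)"
    have "p \<in> positive_cone"
      unfolding p_def using K(2) inv by (intro positive_cone_sum pos) auto
    moreover have "P y - c * c - p = \<alpha> (inv\<^bsub>G\<^esub> k) y - c * c"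
      unfolding P_def p_def using K(2) k(1) by (simp add: sum.remove)
    ultimately show ?thesis
      unfolding E_def using near by (intro CollectI bexI[of _ p]) (simp_all only:)
  qed
  then have "orbit (c * c) \<subseteq> P -` E" by blast
  then have hull: "convex hull orbit (c * c) \<subseteq> P -` E"
    using \<open>linear P\<close> \<open>convex E\<close> by (intro hull_minimal convex_linear_vimage)
  have "\<delta> / (real (card K) + 1) > 0" using \<delta> by simp
  then obtain y where y: "y \<in> convex hull orbit (c * c)" "norm y < \<delta> / (real (card K) + 1)"
    using zero unfolding closure_approachable by (metis dist_0_norm dist_commute)
  have "norm (P y) \<le> (\<Sum>k\<in>K. norm (\<alpha> (inv\<^bsub>G\<^esub> k) y))" unfolding P_def by (rule norm_sum)
  also have "\<dots> = real (card K) * norm y" using inv by (simp add: norm_action)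
  also have "\<dots> \<le> (real (card K) + 1) * norm y" by (simp add: distrib_right)
  also have "\<dots> < \<delta>" using y(2) by (simp add: pos_less_divide_eq mult.commute)
  finally have small: "norm (P y) < \<delta>" .
  obtain p where p: "p \<in> positive_cone" "norm (P y - c * c - p) \<le> \<delta>"
    using hull y(1) unfolding E_def by blast
  have "norm (c * c) \<le> norm (c * c + p)" using sa p(1) by (rule norm_square_le_norm_add_positive)
  also have "c * c + p = P y - (P y - c * c - p)" by simp
  also have "norm \<dots> \<le> norm (P y) + norm (P y - c * c - p)" by (rule norm_triangle_ineq4)
  also have "\<dots> < \<delta> + \<delta>" using small p(2) by simp
  finally show False using \<delta> by (simp add: \<delta>_def)
qed

section \<open>A character separates orbits isometrically\<close>

lemma character_action:
  assumes "character \<phi>" and g: "g \<in> carrier G"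
  shows "star_hom (\<lambda>c. \<phi> (\<alpha> g c))" and "\<phi> (\<alpha> g 1) = 1"
proof -
  have \<phi>: "star_hom \<phi>" using assms by (simp add: character_def)
  show "star_hom (\<lambda>c. \<phi> (\<alpha> g c))"
    unfolding star_hom_def
    by (simp add: star_hom_add[OF \<phi>] star_hom_mult[OF \<phi>] star_hom_star[OF \<phi>] star_hom_scaleC[OF \<phi>]
        star_hom_add[OF star_hom_action[OF g]] star_hom_mult[OF star_hom_action[OF g]]
        star_hom_star[OF star_hom_action[OF g]] star_hom_scaleC[OF star_hom_action[OF g]])
  show "\<phi> (\<alpha> g 1) = 1" using assms by (simp add: action_unit character_one)
qed

text \<open>
  The character also vanishes on the closed convex hull of the orbit of \<open>c\<^sup>2\<close>. So the scalar
  contained in this hull is zero, and faithfulness of the mean applies.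
\<close>

lemma zero_if_character_vanishes_on_orbit:
  assumes \<phi>: "character \<phi>" and sa: "star c = c" and zero: "\<And>g. g \<in> carrier G \<Longrightarrow> \<phi> (\<alpha> g c) = 0"
  shows "c = 0"
proof -
  have hom: "star_hom \<phi>" "\<phi> 1 = 1" using \<phi> by (auto simp: character_def character_one)
  have bl: "bounded_linear \<phi>" using hom by (rule star_hom_bounded_linear)
  have "orbit (c * c) \<subseteq> \<phi> -` {0}"
    using zero by (auto simp: orbit_def star_hom_mult[OF hom(1)] star_hom_mult[OF star_hom_action])
  then have "convex hull orbit (c * c) \<subseteq> \<phi> -` {0}"
    using bl by (intro hull_minimal convex_linear_vimage) (auto simp: bounded_linear.linear)
  moreover have "closed (\<phi> -` {0})"
    using bl by (intro closed_vimage) (auto simp: linear_continuous_on)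
  ultimately have sub: "closure (convex hull orbit (c * c)) \<subseteq> \<phi> -` {0}" by (rule closure_minimal)
  obtain z where z: "z *\<^sub>C 1 \<in> closure (convex hull orbit (c * c))" by (rule exists_scalar_in_closed_hull)
  then have "\<phi> (z *\<^sub>C 1) = 0" using sub by auto
  then have "z = 0" by (simp add: star_hom_scaleC[OF hom(1)] hom(2) scaleC_complex_def)
  then have "z *\<^sub>C 1 = (0 :: 'c)" using scaleC_of_real[of 0 "1::'c"] by simp
  then show ?thesis using zero_if_zero_in_closed_hull[OF sa] z by simp
qed

text \<open>
  Let \<open>p\<close> be the absolute value of \<open>d = c - N\<close>. Every translate of the character is nonpositive on \<open>d\<close> and
  hence kills \<open>p + d\<close>, twice the positive part of \<open>d\<close>. So \<open>p + d = 0\<close>, that is, \<open>N - c = p\<close>.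
\<close>

lemma scalar_minus_mem_positive_cone:
  assumes \<phi>: "character \<phi>" and sa: "star c = c"
    and bound: "\<And>g. g \<in> carrier G \<Longrightarrow> cmod (\<phi> (\<alpha> g c)) \<le> N"
  shows "of_real N - c \<in> positive_cone"
proof -
  define d where "d = c - of_real N"
  have d: "star d = d" using sa by (simp add: d_def)
  have "star (d * d) = d * d" using d by (simp add: star_mult)
  then obtain p where p: "star p = p" "p * p = d * d" "p \<in> positive_cone"
    using positive_square_root square_mem_positive_cone[OF d] by blast
  have "\<phi> (\<alpha> g (p + d)) = 0" if g: "g \<in> carrier G" for g
  proof -
    let ?\<psi> = "\<lambda>c. \<phi> (\<alpha> g c)"
    note \<psi> = character_action[OF \<phi> g]
    have real: "Im (?\<psi> x) = 0" if "star x = x" for x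
      using star_hom_star[OF \<psi>(1), of x] that by (simp add: star_complex_def complex_eq_iff)
    have "?\<psi> p \<in> positive_cone" using star_hom_positive_cone[OF \<psi>] p(3) by simp
    then obtain t where "cmod (of_real t - ?\<psi> p) \<le> t" by (auto simp: positive_cone_def)
    then have "\<bar>t - Re (?\<psi> p)\<bar> \<le> t" using abs_Re_le_cmod[of "of_real t - ?\<psi> p"] by simp
    then have Rp: "Re (?\<psi> p) \<ge> 0" by simp
    have "?\<psi> d = ?\<psi> c - of_real N"
      using star_hom_diff[OF \<psi>(1)] star_hom_of_real[OF \<psi>] by (simp add: d_def)
    then have Rd: "Re (?\<psi> d) \<le> 0" using bound[OF g] complex_Re_le_cmod[of "?\<psi> c"] by simp
    have "?\<psi> p * ?\<psi> p = ?\<psi> d * ?\<psi> d" using star_hom_mult[OF \<psi>(1)] p(2) by metis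
    then have "Re (?\<psi> p) * Re (?\<psi> p) = Re (?\<psi> d) * Re (?\<psi> d)"
      using real p(1) d by (simp add: complex_eq_iff)
    then have "Re (?\<psi> p) = - Re (?\<psi> d)" using Rp Rd by (metis abs_of_nonneg abs_of_nonpos square_eq_iff abs_eq_iff)
    then have "?\<psi> p + ?\<psi> d = 0" using real p(1) d by (simp add: complex_eq_iff)
    then show ?thesis using star_hom_add[OF \<psi>(1)] by simp
  qed
  moreover have "star (p + d) = p + d" using p d by (simp add: star_add)
  ultimately have "p + d = 0" using zero_if_character_vanishes_on_orbit[OF \<phi>] by blast
  then have "of_real N - c = p" by (simp add: d_def algebra_simps eq_neg_iff_add_eq_0)
  then show ?thesis using p by simp
qed

text \<open>
  The map \<open>c \<mapsto> (g \<mapsto> \<phi> (\<alpha> g c))\<close> is isometric for the supremum norm: for self-adjoint \<open>c\<close> both \<open>N - c\<close>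
  and \<open>N + c\<close> are positive, and the C*-identity gives the general case. In particular the algebra embeds into
  an algebra of functions, which is why a single character forces commutativity.
\<close>

theorem norm_le_of_character_bound:
  assumes \<phi>: "character \<phi>"
    and bound: "\<And>g. g \<in> carrier G \<Longrightarrow> cmod (\<phi> (\<alpha> g c)) \<le> N"
  shows "norm c \<le> N"
proof -
  have nonneg: "N \<ge> 0" using bound[OF one_closed] norm_ge_zero order_trans by blast
  have sa: "norm c \<le> M"
    if c: "star c = c" and M: "M \<ge> 0" "\<And>g. g \<in> carrier G \<Longrightarrow> cmod (\<phi> (\<alpha> g c)) \<le> M" for c M
  proof -
    have minus: "cmod (\<phi> (\<alpha> g (- c))) \<le> M" if g: "g \<in> carrier G" for g
      using M(2)[OF g] star_hom_minus[OF character_action(1)[OF \<phi> g]] by simp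
    have "of_real M - c \<in> positive_cone" using \<phi> c M(2) by (rule scalar_minus_mem_positive_cone)
    moreover have "of_real M - - c \<in> positive_cone"
      using \<phi> _ minus by (rule scalar_minus_mem_positive_cone) (simp add: c)
    ultimately show ?thesis using M(1) c by (intro norm_le_of_positive_bounds) auto
  qed
  have "norm (star c * c) \<le> N\<^sup>2"
  proof (rule sa)
    fix g assume g: "g \<in> carrier G"
    note \<psi> = character_action[OF \<phi> g]
    have "cmod (\<phi> (\<alpha> g (star c * c))) = (cmod (\<phi> (\<alpha> g c)))\<^sup>2"
      using star_hom_mult[OF \<psi>(1)] star_hom_star[OF \<psi>(1)] cstar_identity[of "\<phi> (\<alpha> g c)"] by simp
    then show "cmod (\<phi> (\<alpha> g (star c * c))) \<le> N\<^sup>2" using bound[OF g] by (simp add: power_mono)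
  qed (simp_all add: star_mult star_star)
  then have "(norm c)\<^sup>2 \<le> N\<^sup>2" by (simp add: cstar_identity)
  then show ?thesis using nonneg by (rule power2_le_imp_le)
qed

corollary eq_if_character_agrees_on_orbits:
  assumes \<phi>: "character \<phi>" and "\<And>g. g \<in> carrier G \<Longrightarrow> \<phi> (\<alpha> g a) = \<phi> (\<alpha> g b)"
  shows "a = b"
proof -
  have "norm (a - b) \<le> 0"
    using \<phi> by (rule norm_le_of_character_bound) (use assms in \<open>simp add: star_hom_diff[OF character_action(1)]\<close>)
  then show ?thesis by simp
qed

corollary commutative_if_character:
  fixes \<phi> :: "'c \<Rightarrow> complex"
  assumes \<phi>: "character \<phi>"
  shows "a * b = b * (a :: 'c)"
  using \<phi> by (rule eq_if_character_agrees_on_orbits)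
    (simp add: star_hom_mult[OF character_action(1)[OF \<phi>]] mult.commute)

section \<open>The orbit of a character\<close>

text \<open>
  The translate of \<open>\<phi>\<close> by \<open>g\<close>, as a point of the space of all functions on the algebra; its fibres over
  the group will be the cosets of the stabilizer.
\<close>

definition evaluation :: "('c \<Rightarrow> complex) \<Rightarrow> 'g \<Rightarrow> 'c \<Rightarrow> complex"
  where "evaluation \<phi> g = (\<lambda>c. \<phi> (\<alpha> g c))"

lemma continuous_map_evaluation_at:
  assumes \<phi>: "character \<phi>"
  shows "continuous_map T euclidean (\<lambda>g. \<phi> (\<alpha> g c))"
proof -
  have "bounded_linear \<phi>" using \<phi> by (intro star_hom_bounded_linear character_one) (simp add: character_def)
  then have "continuous_map euclidean euclidean \<phi>"
    by (simp add: linear_continuous_on)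
  from continuous_map_compose[OF strongly_continuous this] show ?thesis by (simp add: o_def)
qed

lemma continuous_map_evaluation:
  assumes \<phi>: "character \<phi>"
  shows "continuous_map T euclidean (evaluation \<phi>)"
  unfolding euclidean_product_topology[symmetric] continuous_map_componentwise_UNIV
  using continuous_map_evaluation_at[OF \<phi>] by (simp add: evaluation_def)

text \<open>
  Evaluations at self-adjoint elements form a point-separating algebra of real functions on the
  orbit of the character, so they approximate \<open>u\<close> uniformly by the Stone--Weierstrass theorem. The
  approximants are Cauchy in the algebra by \<open>norm_le_of_character_bound\<close>.
\<close>

lemma exists_self_adjoint_with_values:
  fixes u :: "('c \<Rightarrow> complex) \<Rightarrow> real"
  assumes \<phi>: "character \<phi>" and u: "continuous_on (evaluation \<phi> ` carrier G) u"
  obtains c where "star c = c" "\<And>g. g \<in> carrier G \<Longrightarrow> \<phi> (\<alpha> g c) = of_real (u (evaluation \<phi> g))"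
proof -
  define S where "S = evaluation \<phi> ` carrier G"
  have "compactin T (carrier G)" using compact topspace_eq by (simp add: compact_space_def)
  from image_compactin[OF this continuous_map_evaluation[OF \<phi>]]
  have S: "compact S" by (simp add: S_def)
  have real: "complex_of_real (Re (\<phi> (\<alpha> g c))) = \<phi> (\<alpha> g c)" if "g \<in> carrier G" "star c = c" for g c
    using star_hom_star[OF character_action(1)[OF \<phi> that(1)], of c] that
    by (simp add: star_complex_def complex_eq_iff)
  define R where "R = {f. continuous_on S f \<and> (\<exists>c. star c = c \<and> (\<forall>s\<in>S. f s = Re (s c)))}"
  have cont: "continuous_on S (\<lambda>s. Re (s c))" for c :: 'c
    by (intro continuous_intros continuous_on_product_then_coordinatewise continuous_on_id)
  interpret function_ring_on R S
  proof
    show "compact S" by (rule S)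
    show "continuous_on S f" if "f \<in> R" for f using that by (simp add: R_def)
    show "(\<lambda>_. r) \<in> R" for r
      using star_hom_of_real[OF character_action[OF \<phi>]]
      by (auto simp: R_def S_def evaluation_def intro!: exI[of _ "of_real r"])
    fix f h assume "f \<in> R" "h \<in> R"
    then obtain a b where ab: "star a = a" "star b = b" "\<forall>s\<in>S. f s = Re (s a)" "\<forall>s\<in>S. h s = Re (s b)"
      and c: "continuous_on S f" "continuous_on S h" by (auto simp: R_def)
    have "\<forall>s\<in>S. f s + h s = Re (s (a + b))"
      using ab by (auto simp: S_def evaluation_def star_hom_add[OF character_action(1)[OF \<phi>]])
    then show "(\<lambda>x. f x + h x) \<in> R"
      unfolding R_def using ab c by (intro CollectI conjI continuous_intros exI[of _ "a + b"]) (auto simp: star_add)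
    have "\<forall>s\<in>S. f s * h s = Re (s (a * b))"
    proof
      fix s assume "s \<in> S"
      then obtain g where g: "g \<in> carrier G" "s = evaluation \<phi> g" by (auto simp: S_def)
      have "s (a * b) = s a * s b" using g by (simp add: evaluation_def star_hom_mult[OF character_action(1)[OF \<phi>]])
      also have "\<dots> = of_real (Re (s a)) * of_real (Re (s b))" using g ab real by (simp add: evaluation_def)
      finally show "f s * h s = Re (s (a * b))" using ab \<open>s \<in> S\<close> by simp
    qed
    moreover have "star (a * b) = a * b" using ab commutative_if_character[OF \<phi>] by (simp add: star_mult)
    ultimately show "(\<lambda>x. f x * h x) \<in> R"
      unfolding R_def using c by (intro CollectI conjI continuous_intros exI[of _ "a * b"]) auto
  next
    fix x y assume xy: "x \<in> S" "y \<in> S" "x \<noteq> y"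
    then obtain c where c: "x c \<noteq> y c" by blast
    \<comment> \<open>Some self-adjoint element separates \<open>x\<close> and \<open>y\<close>, because the real or the imaginary part of \<open>c\<close> does.\<close>
    have dec: "s c = s (re_part c) + \<i> * s (im_part c)" if s: "s \<in> S" for s
    proof -
      obtain g where g: "g \<in> carrier G" "s = evaluation \<phi> g" using s by (auto simp: S_def)
      have "\<phi> (\<alpha> g (re_part c + \<i> *\<^sub>C im_part c)) = \<phi> (\<alpha> g (re_part c)) + \<i> * \<phi> (\<alpha> g (im_part c))"
        using character_action(1)[OF \<phi> g(1)] by (simp add: star_hom_def scaleC_complex_def)
      then show ?thesis by (simp add: g evaluation_def re_part_im_part)
    qed
    have "x (re_part c) \<noteq> y (re_part c) \<or> x (im_part c) \<noteq> y (im_part c)"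
      using c dec xy by metis
    then obtain b where b: "star b = b" "x b \<noteq> y b" using star_re_part star_im_part by metis
    have "Re (x b) \<noteq> Re (y b)" using b xy real by (auto simp: S_def evaluation_def) (metis real)
    moreover have "(\<lambda>s. Re (s b)) \<in> R" using b cont by (auto simp: R_def)
    ultimately show "\<exists>f\<in>R. f x \<noteq> f y" by (intro bexI[of _ "\<lambda>s. Re (s b)"])
  qed
  have "\<exists>c. star c = c \<and> (\<forall>s\<in>S. \<bar>u s - Re (s c)\<bar> < inverse (real (Suc n)))" for n
  proof -
    have "inverse (real (Suc n)) > 0" by simp
    from Stone_Weierstrass_basic[OF u[folded S_def] this]
    obtain f where f: "f \<in> R" "\<forall>s\<in>S. \<bar>u s - f s\<bar> < inverse (real (Suc n))" by blast
    then obtain c where "star c = c" "\<forall>s\<in>S. f s = Re (s c)" unfolding R_def by blast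
    then show ?thesis using f(2) by (intro exI[of _ c]) simp
  qed
  then obtain c where c: "\<And>n. star (c n) = c n" "\<And>n s. s \<in> S \<Longrightarrow> \<bar>u s - Re (s (c n))\<bar> < inverse (real (Suc n))"
    by metis
  have app: "cmod (\<phi> (\<alpha> g (c n)) - of_real (u (evaluation \<phi> g))) \<le> inverse (real (Suc n))" if g: "g \<in> carrier G" for g n
  proof -
    have "\<phi> (\<alpha> g (c n)) - of_real (u (evaluation \<phi> g)) = of_real (Re (evaluation \<phi> g (c n)) - u (evaluation \<phi> g))"
      using real[OF g c(1)] by (simp add: evaluation_def)
    then have "cmod (\<phi> (\<alpha> g (c n)) - of_real (u (evaluation \<phi> g))) = \<bar>u (evaluation \<phi> g) - Re (evaluation \<phi> g (c n))\<bar>"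
      by (simp only: norm_of_real)
    then show ?thesis using c(2)[of "evaluation \<phi> g" n] g by (simp add: S_def)
  qed
  have diff: "norm (c m - c n) \<le> inverse (real (Suc m)) + inverse (real (Suc n))" for m n
    using \<phi>
  proof (rule norm_le_of_character_bound)
    fix g assume g: "g \<in> carrier G"
    have "\<phi> (\<alpha> g (c m - c n)) = (\<phi> (\<alpha> g (c m)) - of_real (u (evaluation \<phi> g))) - (\<phi> (\<alpha> g (c n)) - of_real (u (evaluation \<phi> g)))"
      by (simp add: star_hom_diff[OF character_action(1)[OF \<phi> g]])
    then show "cmod (\<phi> (\<alpha> g (c m - c n))) \<le> inverse (real (Suc m)) + inverse (real (Suc n))"
      using order_trans[OF norm_triangle_ineq4 add_mono[OF app[OF g, of m] app[OF g, of n]]] by simp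
  qed
  have "Cauchy c"
  proof (rule CauchyI)
    fix e :: real assume "e > 0"
    then obtain M where M: "inverse (real (Suc M)) < e/2" using reals_Archimedean[of "e/2"] by auto
    have "norm (c m - c n) < e" if "m \<ge> M" "n \<ge> M" for m n
    proof -
      have "inverse (real (Suc m)) \<le> inverse (real (Suc M))" "inverse (real (Suc n)) \<le> inverse (real (Suc M))"
        using that by (simp_all add: le_imp_inverse_le)
      then show ?thesis using diff[of m n] M by linarith
    qed
    then show "\<exists>M. \<forall>m\<ge>M. \<forall>n\<ge>M. norm (c m - c n) < e" by blast
  qed
  then obtain l where l: "c \<longlonglongrightarrow> l" using Cauchy_convergent convergent_def by blast
  then have "c \<longlonglongrightarrow> star l" using tendsto_star[OF l] c(1) by simp
  then have sl: "star l = l" using l by (rule LIMSEQ_unique)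
  have "\<phi> (\<alpha> g l) = of_real (u (evaluation \<phi> g))" if g: "g \<in> carrier G" for g
  proof -
    have "bounded_linear (\<lambda>c. \<phi> (\<alpha> g c))" by (intro star_hom_bounded_linear character_action \<phi> g)
    then have 1: "(\<lambda>n. \<phi> (\<alpha> g (c n))) \<longlonglongrightarrow> \<phi> (\<alpha> g l)" using l by (rule bounded_linear.tendsto)
    have "(\<lambda>n. \<phi> (\<alpha> g (c n)) - of_real (u (evaluation \<phi> g))) \<longlonglongrightarrow> 0"
      using app[OF g] by (intro Lim_null_comparison[OF _ LIMSEQ_inverse_real_of_nat]) auto
    then have "(\<lambda>n. \<phi> (\<alpha> g (c n))) \<longlonglongrightarrow> of_real (u (evaluation \<phi> g))" by (rule LIM_zero_cancel)
    with 1 show ?thesis by (rule LIMSEQ_unique)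
  qed
  then show thesis using that sl by blast
qed

section \<open>The isomorphism with the functions on the coset space\<close>

definition stabilizer :: "('c \<Rightarrow> complex) \<Rightarrow> 'g set"
  where "stabilizer \<phi> = {k \<in> carrier G. \<forall>c. \<phi> (\<alpha> k c) = \<phi> c}"

lemma subgroup_stabilizer: "subgroup (stabilizer \<phi>) G"
proof (rule subgroupI)
  show "stabilizer \<phi> \<subseteq> carrier G" by (auto simp: stabilizer_def)
  show "stabilizer \<phi> \<noteq> {}" using action_one one_closed by (auto simp: stabilizer_def)
  show "inv\<^bsub>G\<^esub> a \<in> stabilizer \<phi>" if "a \<in> stabilizer \<phi>" for a
  proof -
    have a: "a \<in> carrier G" "\<And>c. \<phi> (\<alpha> a c) = \<phi> c" using that by (auto simp: stabilizer_def)
    have "\<phi> (\<alpha> (inv\<^bsub>G\<^esub> a) c) = \<phi> c" for c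
      using a(2)[of "\<alpha> (inv\<^bsub>G\<^esub> a) c"] action_inv_left[of "inv\<^bsub>G\<^esub> a" c] a(1) by simp
    then show ?thesis using a by (simp add: stabilizer_def)
  qed
  show "a \<otimes>\<^bsub>G\<^esub> b \<in> stabilizer \<phi>" if "a \<in> stabilizer \<phi>" "b \<in> stabilizer \<phi>" for a b
    using that by (auto simp: stabilizer_def action_mult)
qed

lemma closedin_stabilizer:
  assumes \<phi>: "character \<phi>"
  shows "closedin T (stabilizer \<phi>)"
proof -
  have "closedin T {k \<in> topspace T. \<phi> (\<alpha> k c) \<in> {\<phi> c}}" for c
    by (rule closedin_continuous_map_preimage[OF continuous_map_evaluation_at[OF \<phi>]]) simp
  then have "closedin T (\<Inter>c. {k \<in> topspace T. \<phi> (\<alpha> k c) \<in> {\<phi> c}})" by (intro closedin_INT) auto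
  moreover have "(\<Inter>c. {k \<in> topspace T. \<phi> (\<alpha> k c) \<in> {\<phi> c}}) = stabilizer \<phi>"
    by (auto simp: stabilizer_def topspace_eq)
  ultimately show ?thesis by simp
qed

lemma evaluation_eq_iff:
  assumes g: "g \<in> carrier G" and h: "h \<in> carrier G"
  shows "evaluation \<phi> g = evaluation \<phi> h \<longleftrightarrow> stabilizer \<phi> #>\<^bsub>G\<^esub> g = stabilizer \<phi> #>\<^bsub>G\<^esub> h"
proof
  assume eq: "evaluation \<phi> g = evaluation \<phi> h"
  have "\<phi> (\<alpha> (g \<otimes>\<^bsub>G\<^esub> inv\<^bsub>G\<^esub> h) c) = \<phi> c" for c
  proof -
    have "\<phi> (\<alpha> (g \<otimes>\<^bsub>G\<^esub> inv\<^bsub>G\<^esub> h) c) = evaluation \<phi> g (\<alpha> (inv\<^bsub>G\<^esub> h) c)"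
      using g h by (simp add: evaluation_def action_mult)
    also have "\<dots> = \<phi> c" unfolding eq using h action_inv_left[of "inv\<^bsub>G\<^esub> h" c] by (simp add: evaluation_def)
    finally show ?thesis .
  qed
  then have "g \<otimes>\<^bsub>G\<^esub> inv\<^bsub>G\<^esub> h \<in> stabilizer \<phi>" using g h by (simp add: stabilizer_def)
  moreover have "(g \<otimes>\<^bsub>G\<^esub> inv\<^bsub>G\<^esub> h) \<otimes>\<^bsub>G\<^esub> h = g" using g h by (simp add: m_assoc)
  ultimately have "g \<in> stabilizer \<phi> #>\<^bsub>G\<^esub> h" by (force simp: r_coset_def)
  then show "stabilizer \<phi> #>\<^bsub>G\<^esub> g = stabilizer \<phi> #>\<^bsub>G\<^esub> h"
    using repr_independence[OF _ h subgroup_stabilizer] by simp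
next
  assume "stabilizer \<phi> #>\<^bsub>G\<^esub> g = stabilizer \<phi> #>\<^bsub>G\<^esub> h"
  then have "g \<in> stabilizer \<phi> #>\<^bsub>G\<^esub> h" using rcos_self[OF g subgroup_stabilizer[of \<phi>]] by simp
  then obtain k where "k \<in> stabilizer \<phi>" "g = k \<otimes>\<^bsub>G\<^esub> h" by (auto simp: r_coset_def)
  then show "evaluation \<phi> g = evaluation \<phi> h" using h by (simp add: stabilizer_def evaluation_def action_mult)
qed

text \<open>
  The Gelfand transform of \<open>c\<close>, restricted to the orbit of \<open>\<phi>\<close> and transported to the coset space. By
  \<open>evaluation_eq_iff\<close> the choice of a representative of the coset does not matter.
\<close>

definition gelfand_transform :: "('c \<Rightarrow> complex) \<Rightarrow> 'c \<Rightarrow> 'g set \<Rightarrow> complex"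
  where "gelfand_transform \<phi> c = (\<lambda>x\<in>rcosets\<^bsub>G\<^esub> stabilizer \<phi>. evaluation \<phi> (SOME g. g \<in> x) c)"

lemma gelfand_transform_coset:
  assumes g: "g \<in> carrier G"
  shows "gelfand_transform \<phi> c (stabilizer \<phi> #>\<^bsub>G\<^esub> g) = \<phi> (\<alpha> g c)"
proof -
  let ?x = "stabilizer \<phi> #>\<^bsub>G\<^esub> g"
  define h where "h = (SOME h. h \<in> ?x)"
  have "h \<in> ?x" unfolding h_def using rcos_self[OF g subgroup_stabilizer] by (rule someI)
  then have "h \<in> carrier G" "?x = stabilizer \<phi> #>\<^bsub>G\<^esub> h"
    using r_coset_subset_G[OF subgroup.subset[OF subgroup_stabilizer] g] repr_independence[OF _ g subgroup_stabilizer]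
    by auto
  then have "evaluation \<phi> h = evaluation \<phi> g" using evaluation_eq_iff[OF _ g] by blast
  then have "evaluation \<phi> h c = \<phi> (\<alpha> g c)" by (simp add: evaluation_def)
  moreover have "?x \<in> rcosets\<^bsub>G\<^esub> stabilizer \<phi>" using g by (auto simp: RCOSETS_def)
  ultimately show ?thesis by (simp add: gelfand_transform_def h_def)
qed

lemma rcosets_cases:
  assumes "x \<in> rcosets\<^bsub>G\<^esub> K"
  obtains g where "g \<in> carrier G" "x = K #>\<^bsub>G\<^esub> g"
  using assms by (auto simp: RCOSETS_def)

lemma gelfand_transform_mem_continuous_functions:
  assumes \<phi>: "character \<phi>"
  shows "gelfand_transform \<phi> c \<in> continuous_functions (right_coset_space G T (stabilizer \<phi>))"
proof -
  have "continuous_map T euclidean (gelfand_transform \<phi> c \<circ> (\<lambda>g. stabilizer \<phi> #>\<^bsub>G\<^esub> g))"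
    by (rule continuous_map_eq[OF continuous_map_evaluation_at[OF \<phi>, of c]]) (simp add: topspace_eq gelfand_transform_coset)
  then have "continuous_map (right_coset_space G T (stabilizer \<phi>)) euclidean (gelfand_transform \<phi> c)"
    by (rule continuous_compose_quotient_map[OF quotient_map_right_coset_space[OF subgroup_stabilizer]])
  then show ?thesis
    by (simp add: continuous_functions_def topspace_right_coset_space[OF subgroup_stabilizer] gelfand_transform_def)
qed

text \<open>
  The group is compact and the space of functionals is Hausdorff, so \<open>evaluation \<phi>\<close> is a quotient map onto
  the orbit and \<open>f\<close> descends to a continuous function there, to which
  \<open>exists_self_adjoint_with_values\<close> applies.
\<close>

lemma gelfand_transform_surjective:
  assumes \<phi>: "character \<phi>" and f: "f \<in> continuous_functions (right_coset_space G T (stabilizer \<phi>))"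
  obtains c where "gelfand_transform \<phi> c = f"
proof -
  let ?K = "stabilizer \<phi>" and ?e = "evaluation \<phi>"
  define S where "S = ?e ` carrier G"
  define F where "F s = f (?K #>\<^bsub>G\<^esub> (SOME g. g \<in> carrier G \<and> ?e g = s))" for s
  have F: "F (?e g) = f (?K #>\<^bsub>G\<^esub> g)" if g: "g \<in> carrier G" for g
  proof -
    have "(SOME h. h \<in> carrier G \<and> ?e h = ?e g) \<in> carrier G \<and> ?e (SOME h. h \<in> carrier G \<and> ?e h = ?e g) = ?e g"
      by (rule someI[of _ g]) (simp add: g)
    then show ?thesis unfolding F_def using evaluation_eq_iff g by metis
  qed
  have e: "continuous_map T (top_of_set S) ?e"
    using continuous_map_evaluation[OF \<phi>] by (auto simp: continuous_map_in_subtopology S_def topspace_eq)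
  have "Hausdorff_space (product_topology (\<lambda>_::'c. euclidean :: complex topology) UNIV)"
    by (simp add: Hausdorff_space_product_topology)
  then have "Hausdorff_space (top_of_set S)"
    unfolding euclidean_product_topology by (rule Hausdorff_space_subtopology)
  then have "closed_map T (top_of_set S) ?e" by (rule continuous_imp_closed_map[OF e compact])
  then have quot: "quotient_map T (top_of_set S) ?e"
    using e by (intro continuous_closed_imp_quotient_map) (auto simp: S_def topspace_eq)
  have "continuous_map T euclidean (f \<circ> (\<lambda>g. ?K #>\<^bsub>G\<^esub> g))"
    using f quotient_imp_continuous_map[OF quotient_map_right_coset_space[OF subgroup_stabilizer]]
    by (intro continuous_map_compose) (auto simp: continuous_functions_def)
  then have "continuous_map T euclidean (F \<circ> ?e)"
    by (rule continuous_map_eq) (simp add: topspace_eq F)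
  then have "continuous_map (top_of_set S) euclidean F"
    by (rule continuous_compose_quotient_map[OF quot])
  then have F_cont: "continuous_on S F" by simp
  have Re: "continuous_on S (\<lambda>s. Re (F s))" and Im: "continuous_on S (\<lambda>s. Im (F s))"
    using F_cont by (simp_all add: continuous_on_Re continuous_on_Im)
  obtain a where a: "\<And>g. g \<in> carrier G \<Longrightarrow> \<phi> (\<alpha> g a) = of_real (Re (F (?e g)))"
    using exists_self_adjoint_with_values[OF \<phi> Re[unfolded S_def]] by blast
  obtain b where b: "\<And>g. g \<in> carrier G \<Longrightarrow> \<phi> (\<alpha> g b) = of_real (Im (F (?e g)))"
    using exists_self_adjoint_with_values[OF \<phi> Im[unfolded S_def]] by blast
  have "gelfand_transform \<phi> (a + \<i> *\<^sub>C b) x = f x" for x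
  proof (cases "x \<in> rcosets\<^bsub>G\<^esub> ?K")
    case True
    then obtain g where g: "g \<in> carrier G" "x = ?K #>\<^bsub>G\<^esub> g" by (rule rcosets_cases)
    have "gelfand_transform \<phi> (a + \<i> *\<^sub>C b) x = \<phi> (\<alpha> g a) + \<i> * \<phi> (\<alpha> g b)"
      using g character_action(1)[OF \<phi> g(1)] by (simp add: gelfand_transform_coset star_hom_def scaleC_complex_def)
    also have "\<dots> = F (?e g)" using a b g by (simp add: complex_eq_iff)
    finally show ?thesis using F g by simp
  next
    case False
    then show ?thesis
      using f by (simp add: gelfand_transform_def continuous_functions_def extensional_def topspace_right_coset_space[OF subgroup_stabilizer])
  qed
  then show thesis using that by blast
qed

theorem gelfand_transform_star_iso:
  assumes \<phi>: "character \<phi>"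
  shows "star_iso_onto_continuous_functions (right_coset_space G T (stabilizer \<phi>)) (gelfand_transform \<phi>)"
  unfolding star_iso_onto_continuous_functions_def topspace_right_coset_space[OF subgroup_stabilizer]
proof (intro conjI allI ballI)
  show "bij_betw (gelfand_transform \<phi>) UNIV (continuous_functions (right_coset_space G T (stabilizer \<phi>)))"
    unfolding bij_betw_def
  proof
    show "inj (gelfand_transform \<phi>)"
    proof (rule injI)
      fix a b assume "gelfand_transform \<phi> a = gelfand_transform \<phi> b"
      then show "a = b" using eq_if_character_agrees_on_orbits[OF \<phi>] gelfand_transform_coset by metis
    qed
    show "range (gelfand_transform \<phi>) = continuous_functions (right_coset_space G T (stabilizer \<phi>))"
      using gelfand_transform_mem_continuous_functions[OF \<phi>] gelfand_transform_surjective[OF \<phi>] by blast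
  qed
  fix a b :: 'c and z and x assume "x \<in> rcosets\<^bsub>G\<^esub> stabilizer \<phi>"
  then obtain g where g: "g \<in> carrier G" "x = stabilizer \<phi> #>\<^bsub>G\<^esub> g" by (rule rcosets_cases)
  note \<psi> = character_action(1)[OF \<phi> g(1)]
  show "gelfand_transform \<phi> (a + b) x = gelfand_transform \<phi> a x + gelfand_transform \<phi> b x"
    "gelfand_transform \<phi> (z *\<^sub>C a) x = z * gelfand_transform \<phi> a x"
    "gelfand_transform \<phi> (a * b) x = gelfand_transform \<phi> a x * gelfand_transform \<phi> b x"
    "gelfand_transform \<phi> (star a) x = cnj (gelfand_transform \<phi> a x)"
    using \<psi> g by (auto simp: gelfand_transform_coset star_hom_def scaleC_complex_def star_complex_def)
qed

lemma gelfand_transform_equivariant: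
  assumes g: "g \<in> carrier G" and x: "x \<in> rcosets\<^bsub>G\<^esub> stabilizer \<phi>"
  shows "gelfand_transform \<phi> (\<alpha> g c) x = gelfand_transform \<phi> c (x #>\<^bsub>G\<^esub> g)"
proof -
  obtain h where h: "h \<in> carrier G" "x = stabilizer \<phi> #>\<^bsub>G\<^esub> h" using x by (rule rcosets_cases)
  have "x #>\<^bsub>G\<^esub> g = stabilizer \<phi> #>\<^bsub>G\<^esub> (h \<otimes>\<^bsub>G\<^esub> g)"
    using g h coset_mult_assoc[OF subgroup.subset[OF subgroup_stabilizer]] by simp
  then show ?thesis using g h by (simp add: gelfand_transform_coset action_mult)
qed

end

theorem proposition7p1:
  fixes G :: "('g, 'm) monoid_scheme"
    and T :: "'g topology"
    and \<alpha> :: "'g \<Rightarrow> 'c::unital_cstar_algebra \<Rightarrow> 'c"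
  assumes "ergodic_action G T \<alpha>"
  shows "((\<exists>\<phi> :: 'c \<Rightarrow> complex. character \<phi>) \<longleftrightarrow> (\<forall>a b :: 'c. a * b = b * a)) \<and>
    ((\<exists>\<phi> :: 'c \<Rightarrow> complex. character \<phi>) \<or> (\<forall>a b :: 'c. a * b = b * a) \<longrightarrow>
      (\<exists>K (\<Phi> :: 'c \<Rightarrow> 'g set \<Rightarrow> complex).
        subgroup K G \<and> closedin T K \<and>
        star_iso_onto_continuous_functions (right_coset_space G T K) \<Phi> \<and>
        (\<forall>g\<in>carrier G. \<forall>c. \<forall>x\<in>rcosets\<^bsub>G\<^esub> K.
          \<Phi> (\<alpha> g c) x = \<Phi> c (x #>\<^bsub>G\<^esub> g))))"
proof -
  interpret ergodic_action G T \<alpha> by (rule assms)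
  have equiv: "(\<exists>\<phi> :: 'c \<Rightarrow> complex. character \<phi>) \<longleftrightarrow> (\<forall>a b :: 'c. a * b = b * a)"
    using commutative_if_character exists_character_if_commutative by blast
  have "\<exists>K (\<Phi> :: 'c \<Rightarrow> 'g set \<Rightarrow> complex).
      subgroup K G \<and> closedin T K \<and>
      star_iso_onto_continuous_functions (right_coset_space G T K) \<Phi> \<and>
      (\<forall>g\<in>carrier G. \<forall>c. \<forall>x\<in>rcosets\<^bsub>G\<^esub> K. \<Phi> (\<alpha> g c) x = \<Phi> c (x #>\<^bsub>G\<^esub> g))"
    if \<phi>: "character \<phi>" for \<phi> :: "'c \<Rightarrow> complex"
  proof (intro exI conjI ballI allI)
    show "subgroup (stabilizer \<phi>) G" by (rule subgroup_stabilizer)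
    show "closedin T (stabilizer \<phi>)" using \<phi> by (rule closedin_stabilizer)
    show "star_iso_onto_continuous_functions (right_coset_space G T (stabilizer \<phi>)) (gelfand_transform \<phi>)"
      using \<phi> by (rule gelfand_transform_star_iso)
    show "gelfand_transform \<phi> (\<alpha> g c) x = gelfand_transform \<phi> c (x #>\<^bsub>G\<^esub> g)"
      if "g \<in> carrier G" "x \<in> rcosets\<^bsub>G\<^esub> stabilizer \<phi>" for g c x
      using that by (rule gelfand_transform_equivariant)
  qed
  with equiv show ?thesis by blast
qed

end
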